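(* Let $p\ge5$ be prime, set $h=\frac12\gcd(p-1,24)$, and let $k$ be an even integer. Then there exist integers $r_1,r_p$ with $f(\tau)=\eta^{r_1}(\tau)\eta^{r_p}(p\tau)\in M_k(\Gamma_1(p))$ if and only if both of the following hold: (1) $h\mid k$; (2) it is not the case that $p\neq5$, $p\equiv5\pmod{24}$, and $k=2$.
   Context: $\eta(\tau)=q^{1/24}\prod_{n\ge1}(1-q^n)$, $q=e^{2\pi i\tau}$. $M_k(\Gamma_1(p))$ is the space of holomorphic modular forms of weight $k$ on $\Gamma_1(p)$ (holomorphic on the upper half-plane and at all cusps).
   Formalization: The even integer k is assumed nonnegative; for negative k the claim as worded fails (p=5, k=-2 satisfies (1) and (2), but M_{-2}(Γ_1(5))={0} while eta quotients never vanish). *)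

theory Defs
  imports "HOL-Complex_Analysis.Complex_Analysis" "HOL-Number_Theory.Number_Theory"
begin

definition upper_half_plane :: "complex set" where
  "upper_half_plane = {\<tau>. Im \<tau> > 0}"

text \<open>The factor \<open>q\<^bsup>1/24\<^esup>\<close> means \<open>e\<^bsup>2\<pi>i\<tau>/24\<^esup>\<close>, which is not the principal 24th root of \<open>q\<close>.\<close>

definition dedekind_eta :: "complex \<Rightarrow> complex" where
  "dedekind_eta \<tau> =
     exp (2 * of_real pi * \<i> * \<tau> / 24) * (\<Prod>n. 1 - exp (2 * of_real pi * \<i> * \<tau>) ^ Suc n)"

definition SL2Z :: "(int ^ 2 ^ 2) set" where
  "SL2Z = {A. det A = 1}"

definition Gamma1 :: "nat \<Rightarrow> (int ^ 2 ^ 2) set" where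
  "Gamma1 N = {A \<in> SL2Z.
     [A $ 1 $ 1 = 1] (mod int N) \<and> [A $ 2 $ 1 = 0] (mod int N) \<and> [A $ 2 $ 2 = 1] (mod int N)}"

definition moebius_act :: "int ^ 2 ^ 2 \<Rightarrow> complex \<Rightarrow> complex" where
  "moebius_act A \<tau> =
     (of_int (A $ 1 $ 1) * \<tau> + of_int (A $ 1 $ 2)) / (of_int (A $ 2 $ 1) * \<tau> + of_int (A $ 2 $ 2))"

definition slash :: "int \<Rightarrow> (complex \<Rightarrow> complex) \<Rightarrow> int ^ 2 ^ 2 \<Rightarrow> complex \<Rightarrow> complex" where
  "slash k f A \<tau> =
     (of_int (A $ 2 $ 1) * \<tau> + of_int (A $ 2 $ 2)) powi (- k) * f (moebius_act A \<tau>)"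

text \<open>\<open>f\<close> is a function of \<open>q\<^sub>N = e\<^bsup>2\<pi>i\<tau>/N\<^esup>\<close> that extends holomorphically to \<open>q\<^sub>N = 0\<close>; equivalently,
  \<open>f\<close> has an expansion in nonnegative powers of \<open>q\<^sub>N\<close>.\<close>

definition holomorphic_at_infinity :: "nat \<Rightarrow> (complex \<Rightarrow> complex) \<Rightarrow> bool" where
  "holomorphic_at_infinity N f \<longleftrightarrow>
     (\<exists>g. g holomorphic_on ball 0 1 \<and>
          (\<forall>\<tau>\<in>upper_half_plane. f \<tau> = g (exp (2 * of_real pi * \<i> * \<tau> / of_nat N))))"

text \<open>The space \<open>M\<^sub>k(\<Gamma>\<^sub>1(N))\<close>. Modular forms are functions on the upper half-plane, so values
  elsewhere are unconstrained. Every cusp is the image of \<open>\<infinity>\<close> under some \<open>A \<in> SL\<^sub>2(\<int>)\<close>,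
  and the width of each cusp of \<open>\<Gamma>\<^sub>1(N)\<close> divides \<open>N\<close>, so \<open>q\<^sub>N\<close> can be used at all of them.\<close>

definition modular_forms_Gamma1 :: "int \<Rightarrow> nat \<Rightarrow> (complex \<Rightarrow> complex) set" where
  "modular_forms_Gamma1 k N = {f.
     f holomorphic_on upper_half_plane \<and>
     (\<forall>A\<in>Gamma1 N. \<forall>\<tau>\<in>upper_half_plane. slash k f A \<tau> = f \<tau>) \<and>
     (\<forall>A\<in>SL2Z. holomorphic_at_infinity N (slash k f A))}"

end

theory Submission
  imports Defs
begin

text \<open>
  The Jacobi theta function, normalised to have derivative 1 at the origin and written as an infinite
  product, is determined up to a constant by its quasi-periods and zeros, so by Liouville's theorem it
  transforms under all of \<open>SL\<^sub>2(\<int>)\<close> without any multiplier. The resulting Klein forms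
  \<open>K\<^sub>a(\<tau>)\<close> satisfy \<open>K\<^sub>a(A\<tau>) = (c\<tau> + d)\<^sup>-\<^sup>1 K\<^sub>a\<^sub>A(\<tau>)\<close> and change by a root of unity when
  \<open>a\<close> is shifted by an integral vector.

  Up to a constant, \<open>K\<^sub>a \<eta>\<^sup>2\<close> is the Siegel function, an explicit product in \<open>q\<close>. The Siegel functions at
  the three points of order 2 multiply to a constant, which makes \<open>\<eta>\<^sup>2\<^sup>4\<close> modular of weight 12. For \<open>N\<close>
  coprime to 6, those at the points \<open>(j/N, 0)\<close> with \<open>1 \<le> j \<le> (N-1)/2\<close>, evaluated at \<open>N\<tau>\<close>, multiply to
  \<open>\<eta>(\<tau>) / \<eta>(N\<tau>)\<close>, which makes \<open>\<eta>(\<tau>) / \<eta>(N\<tau>)\<^sup>N\<close> modular of weight \<open>-(N-1)/2\<close> on \<open>\<Gamma>\<^sub>1(N)\<close>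
  with trivial character.

  Since \<open>\<eta>(\<tau>)\<^sup>r \<eta>(N\<tau>)\<^sup>s\<close> is the \<open>r\<close>-th power of this quotient times \<open>\<eta>(N\<tau>)\<close> to the power \<open>N r + s\<close>, it
  has weight \<open>k\<close> and trivial character exactly when \<open>r + s = 2k\<close> and \<open>24\<close> divides \<open>N r + s\<close>. Its order at
  the cusp \<open>a/c\<close> is proportional to \<open>N r + e\<^sup>2 s\<close> with \<open>e = gcd(c, N)\<close>; this is linear in \<open>e\<^sup>2\<close>, so only
  \<open>e = 1\<close> and \<open>e = N\<close> matter. The rest is arithmetic modulo 24.
\<close>

section \<open>Infinite products\<close>

lemma uniform_limit_prodinf_Weierstrass:
  fixes f :: "nat \<Rightarrow> complex \<Rightarrow> complex"
  assumes A: "compact A" and cont: "\<And>n. continuous_on A (f n)"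
    and M: "summable M" and bound: "\<And>n x. x \<in> A \<Longrightarrow> norm (f n x - 1) \<le> M n"
  shows "uniform_limit A (\<lambda>N x. \<Prod>n<N. f n x) (\<lambda>x. \<Prod>n. f n x) sequentially"
proof -
  have "uniformly_convergent_on A (\<lambda>N x. \<Sum>n<N. norm (f n x - 1))"
    by (rule Weierstrass_m_test'[OF _ M]) (use bound in auto)
  then have "uniformly_convergent_on A (\<lambda>N x. \<Prod>n<N. f n x)"
    by (intro uniformly_convergent_on_prod' cont A)
  then have "uniform_limit A (\<lambda>N x. \<Prod>n<N. f n x) (\<lambda>x. lim (\<lambda>N. \<Prod>n<N. f n x)) sequentially"
    by (simp add: uniformly_convergent_uniform_limit_iff)
  moreover have "lim (\<lambda>N. \<Prod>n<N. f n x) = (\<Prod>n. f n x)" if "x \<in> A" for x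
  proof -
    have "summable (\<lambda>n. norm (f n x - 1))"
      by (rule summable_comparison_test[OF _ M]) (use bound that in auto)
    then have "convergent_prod (\<lambda>n. f n x)"
      by (intro abs_convergent_prod_imp_convergent_prod summable_imp_abs_convergent_prod)
    then have "(\<lambda>N. \<Prod>n<N. f n x) \<longlonglongrightarrow> (\<Prod>n. f n x)"
      using convergent_prod_LIMSEQ by (simp add: LIMSEQ_lessThan_iff_atMost)
    then show ?thesis by (rule limI)
  qed
  ultimately show ?thesis
    using uniform_limit_cong'[of A "\<lambda>N x. \<Prod>n<N. f n x" "\<lambda>N x. \<Prod>n<N. f n x"
      "\<lambda>x. lim (\<lambda>N. \<Prod>n<N. f n x)" "\<lambda>x. \<Prod>n. f n x" sequentially] by auto
qed

lemma holomorphic_on_prodinf: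
  fixes f :: "nat \<Rightarrow> complex \<Rightarrow> complex"
  assumes S: "open S" and hol: "\<And>n. f n holomorphic_on S"
    and bound: "\<And>A. compact A \<Longrightarrow> A \<subseteq> S \<Longrightarrow>
      \<exists>M. summable M \<and> (\<forall>n. \<forall>x\<in>A. norm (f n x - 1) \<le> M n)"
  shows "(\<lambda>z. \<Prod>n. f n z) holomorphic_on S"
proof (rule holomorphic_uniform_sequence[OF S, of "\<lambda>N z. \<Prod>n<N. f n z"])
  show "(\<lambda>z. \<Prod>n<N. f n z) holomorphic_on S" for N
    by (intro holomorphic_on_prod hol)
  fix x assume "x \<in> S"
  then obtain d where d: "d > 0" "cball x d \<subseteq> S"
    using S open_contains_cball by blast
  then obtain M where "summable M" "\<And>n y. y \<in> cball x d \<Longrightarrow> norm (f n y - 1) \<le> M n"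
    using bound[of "cball x d"] by (meson compact_cball)
  moreover have "continuous_on (cball x d) (f n)" for n
    by (intro holomorphic_on_imp_continuous_on holomorphic_on_subset[OF hol d(2)])
  ultimately have "uniform_limit (cball x d) (\<lambda>N z. \<Prod>n<N. f n z) (\<lambda>z. \<Prod>n. f n z) sequentially"
    by (intro uniform_limit_prodinf_Weierstrass compact_cball)
  with d show "\<exists>d>0. cball x d \<subseteq> S \<and>
      uniform_limit (cball x d) (\<lambda>N z. \<Prod>n<N. f n z) (\<lambda>z. \<Prod>n. f n z) sequentially"
    by blast
qed

definition qpoch :: "complex \<Rightarrow> complex \<Rightarrow> complex" where
  "qpoch x q = (\<Prod>n. 1 - x * q ^ n)"

lemma qpoch_0_left [simp]: "qpoch 0 q = 1"
  by (simp add: qpoch_def)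

lemma convergent_prod_qpoch:
  fixes x q :: complex
  assumes "norm q < 1"
  shows "convergent_prod (\<lambda>n. 1 - x * q ^ n)"
proof -
  have "summable (\<lambda>n. norm x * norm q ^ n)"
    using assms by (intro summable_mult summable_geometric) auto
  then show ?thesis
    by (intro abs_convergent_prod_imp_convergent_prod summable_imp_abs_convergent_prod)
       (simp add: norm_mult norm_power)
qed

lemma has_prod_qpoch: "norm q < 1 \<Longrightarrow> (\<lambda>n. 1 - x * q ^ n) has_prod qpoch x q"
  unfolding qpoch_def using convergent_prod_qpoch by blast

lemma qpoch_LIMSEQ:
  assumes "norm q < 1"
  shows "(\<lambda>N. \<Prod>n<N. 1 - x * q ^ n) \<longlonglongrightarrow> qpoch x q"
  unfolding qpoch_def using convergent_prod_LIMSEQ[OF convergent_prod_qpoch[OF assms]]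
  by (simp add: LIMSEQ_lessThan_iff_atMost)

lemma qpoch_eq_0_iff:
  assumes "norm q < 1"
  shows "qpoch x q = 0 \<longleftrightarrow> (\<exists>n. x * q ^ n = 1)"
  using has_prod_eq_0_iff[OF has_prod_qpoch[OF assms, of x]] by (auto simp: image_iff)

lemma qpoch_nonzero:
  assumes q: "norm q < 1" and x: "norm x < 1"
  shows "qpoch x q \<noteq> 0"
proof -
  have "norm (x * q ^ n) < 1" for n
  proof -
    have "norm x * norm q ^ n \<le> norm x * 1"
      using q by (intro mult_left_mono power_le_one) auto
    with x show ?thesis by (simp add: norm_mult norm_power)
  qed
  then have "x * q ^ n \<noteq> 1" for n by (metis norm_one less_irrefl)
  then show ?thesis by (simp add: qpoch_eq_0_iff[OF q])
qed

lemma qpoch_rec: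
  assumes "norm q < 1"
  shows "qpoch x q = (1 - x) * qpoch (x * q) q"
  using has_prod_ignore_initial_segment'[OF convergent_prod_qpoch[OF assms, of x], of 1]
  by (simp add: has_prod_iff qpoch_def algebra_simps)

lemma qpoch_mult_minus:
  assumes "norm q < 1"
  shows "qpoch x q * qpoch (- x) q = qpoch (x\<^sup>2) (q\<^sup>2)"
  unfolding qpoch_def prodinf_mult[OF convergent_prod_qpoch[OF assms] convergent_prod_qpoch[OF assms]]
proof (intro prodinf_cong)
  fix n
  have "(q\<^sup>2) ^ n = (q ^ n)\<^sup>2" by (metis power_mult mult.commute)
  then show "(1 - x * q ^ n) * (1 - - x * q ^ n) = 1 - x\<^sup>2 * (q\<^sup>2) ^ n"
    by (simp add: power2_eq_square algebra_simps)
qed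

lemma qpoch_split_residues:
  assumes q: "norm q < 1" and N: "N > 0"
  shows "(\<Prod>j<N. qpoch (x * q ^ j) (q ^ N)) = qpoch x q"
proof -
  have partial: "(\<Prod>n<M * N. 1 - x * q ^ n) = (\<Prod>j<N. \<Prod>m<M. 1 - x * q ^ j * (q ^ N) ^ m)" for M
  proof -
    have block: "(\<Prod>n\<in>{m * N..<m * N + N}. 1 - x * q ^ n) = (\<Prod>j<N. 1 - x * q ^ j * (q ^ N) ^ m)" for m
      using prod.shift_bounds_nat_ivl[of "\<lambda>n. 1 - x * q ^ n" 0 "m * N" N]
      by (simp add: add.commute power_add power_mult[symmetric] mult_ac atLeast0LessThan)
    have "(\<Prod>n<M * N. 1 - x * q ^ n) = (\<Prod>m<M. \<Prod>n\<in>{m * N..<m * N + N}. 1 - x * q ^ n)"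
      by (rule prod.nat_group[symmetric])
    also have "\<dots> = (\<Prod>j<N. \<Prod>m<M. 1 - x * q ^ j * (q ^ N) ^ m)"
      unfolding block by (rule prod.swap)
    finally show ?thesis .
  qed
  have "norm (q ^ N) < 1"
    using q N by (simp add: norm_power power_less_one_iff)
  then have "(\<lambda>M. \<Prod>n<M * N. 1 - x * q ^ n) \<longlonglongrightarrow> (\<Prod>j<N. qpoch (x * q ^ j) (q ^ N))"
    unfolding partial by (intro tendsto_prod qpoch_LIMSEQ)
  moreover have "(\<lambda>M. \<Prod>n<M * N. 1 - x * q ^ n) \<longlonglongrightarrow> qpoch x q"
    using LIMSEQ_subseq_LIMSEQ[OF qpoch_LIMSEQ[OF q, of x], of "\<lambda>M. M * N"] N
    by (simp add: strict_mono_def o_def)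
  ultimately show ?thesis by (rule LIMSEQ_unique)
qed

lemma holomorphic_on_qpoch [holomorphic_intros]:
  assumes S: "open S" and a: "a holomorphic_on S" and b: "b holomorphic_on S"
    and b_less: "\<And>z. z \<in> S \<Longrightarrow> norm (b z) < 1"
  shows "(\<lambda>z. qpoch (a z) (b z)) holomorphic_on S"
  unfolding qpoch_def
proof (rule holomorphic_on_prodinf[OF S])
  show "(\<lambda>z. 1 - a z * b z ^ n) holomorphic_on S" for n
    by (intro holomorphic_intros a b)
  fix A assume A: "compact A" "A \<subseteq> S"
  show "\<exists>M. summable M \<and> (\<forall>n. \<forall>z\<in>A. norm (1 - a z * b z ^ n - 1) \<le> M n)"
  proof (cases "A = {}")
    case True
    then show ?thesis by (intro exI[of _ "\<lambda>_. 0"]) auto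
  next
    case False
    have "continuous_on A (\<lambda>z. norm (a z))" "continuous_on A (\<lambda>z. norm (b z))"
      using A(2) a b by (auto intro!: continuous_on_norm intro: holomorphic_on_imp_continuous_on
        holomorphic_on_subset)
    then obtain u v where u: "\<And>z. z \<in> A \<Longrightarrow> norm (a z) \<le> norm (a u)"
      and v: "v \<in> A" "\<And>z. z \<in> A \<Longrightarrow> norm (b z) \<le> norm (b v)"
      using continuous_attains_sup[OF A(1) False] by metis
    have "summable (\<lambda>n. norm (a u) * norm (b v) ^ n)"
      using b_less v(1) A(2) by (intro summable_mult summable_geometric) auto
    moreover have "norm (1 - a z * b z ^ n - 1) \<le> norm (a u) * norm (b v) ^ n" if "z \<in> A" for n z
      using u[OF that] v(2)[OF that]
      by (auto simp: norm_mult norm_power intro!: mult_mono power_mono)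
    ultimately show ?thesis by blast
  qed
qed

definition qtheta :: "complex \<Rightarrow> complex \<Rightarrow> complex" where
  "qtheta x q = qpoch x q * qpoch (q / x) q"

lemma qtheta_mult_q:
  assumes q: "norm q < 1" "q \<noteq> 0" and x: "x \<noteq> 0"
  shows "qtheta (x * q) q = - (1 / x) * qtheta x q"
proof -
  have reflect: "x * qpoch (1 / x) q = - ((1 - x) * qpoch (q / x) q)"
    using qpoch_rec[OF q(1), of "1 / x"] x by (simp add: field_simps)
  have "x * qtheta (x * q) q = qpoch (x * q) q * (x * qpoch (1 / x) q)"
    using q(2) by (simp add: qtheta_def)
  also have "\<dots> = - qtheta x q"
    unfolding reflect by (simp add: qtheta_def qpoch_rec[OF q(1), of x] mult_ac)
  finally show ?thesis using x by (simp add: field_simps)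
qed

lemma qtheta_eq_0_iff:
  assumes q: "norm q < 1" "q \<noteq> 0" and x: "x \<noteq> 0"
  shows "qtheta x q = 0 \<longleftrightarrow> (\<exists>n::int. x = q powi n)"
proof -
  have left: "x * q ^ n = 1 \<longleftrightarrow> x = q powi (- int n)" for n
    using q(2) by (auto simp: power_int_minus field_simps)
  have right: "q / x * q ^ n = 1 \<longleftrightarrow> x = q powi (1 + int n)" for n
    using q(2) x by (auto simp: power_int_add field_simps)
  have "n \<le> 0 \<and> n = - int (nat (- n)) \<or> n = 1 + int (nat (n - 1))" for n :: int by linarith
  then show ?thesis
    unfolding qtheta_def mult_eq_0_iff qpoch_eq_0_iff[OF q(1)] left right by metis
qed

lemma qtheta_half_period_product:
  assumes "norm s < 1" "s \<noteq> 0"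
  shows "qtheta s (s\<^sup>2) * qtheta (-1) (s\<^sup>2) * qtheta (- s) (s\<^sup>2) = 2"
proof -
  define q where "q = s\<^sup>2"
  have q: "norm q < 1" using assms by (simp add: q_def norm_power power_less_one_iff)
  have "qpoch (- 1) q = 2 * qpoch (- q) q"
    using qpoch_rec[OF q, of "-1"] by simp
  moreover have "q / s = s" "q / - s = - s" using assms by (simp_all add: q_def power2_eq_square)
  ultimately have "qtheta s q * qtheta (-1) q * qtheta (- s) q =
      2 * (qpoch s q * qpoch (- s) q * qpoch (- q) q)\<^sup>2"
    by (simp add: qtheta_def power2_eq_square mult_ac)
  also have "qpoch s q * qpoch (- s) q * qpoch (- q) q = 1"
  proof -
    have "qpoch s q * qpoch (- s) q = qpoch q (q\<^sup>2)"
      using qpoch_mult_minus[OF q, of s] by (simp add: q_def)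
    moreover have "qpoch q q * qpoch (- q) q = qpoch (q\<^sup>2) (q\<^sup>2)"
      by (rule qpoch_mult_minus[OF q])
    moreover have "qpoch q (q\<^sup>2) * qpoch (q\<^sup>2) (q\<^sup>2) = qpoch q q"
      using qpoch_split_residues[OF q, of 2 q] by (simp add: numeral_2_eq_2)
    ultimately have "qpoch q q * (qpoch s q * qpoch (- s) q * qpoch (- q) q) = qpoch q q"
      by (metis mult.assoc mult.commute)
    then show ?thesis using qpoch_nonzero[OF q q] by simp
  qed
  finally show ?thesis by (simp add: q_def)
qed

lemma prod_qtheta_powers:
  assumes q: "norm q < 1" "q \<noteq> 0" and N: "odd N"
  shows "(\<Prod>j=1..N div 2. qtheta (q ^ j) (q ^ N)) * qpoch (q ^ N) (q ^ N) = qpoch q q"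
proof -
  define n where "n = N div 2"
  define P where "P = (\<lambda>j. qpoch (q ^ j) (q ^ N))"
  have N_eq: "N = Suc (2 * n)" using N by (simp add: n_def)
  have "qtheta (q ^ j) (q ^ N) = P j * P (N - j)" if "j \<in> {1..n}" for j
    using that q(2) N_eq by (simp add: qtheta_def P_def power_diff)
  then have "(\<Prod>j=1..n. qtheta (q ^ j) (q ^ N)) = (\<Prod>j=1..n. P j) * (\<Prod>j=1..n. P (N - j))"
    by (simp add: prod.distrib)
  also have "(\<Prod>j=1..n. P (N - j)) = (\<Prod>j=n+1..n+n. P j)"
    by (rule prod.reindex_bij_witness[of _ "\<lambda>j. N - j" "\<lambda>j. N - j"]) (use N_eq in auto)
  also have "(\<Prod>j=1..n. P j) * \<dots> = (\<Prod>j=1..n+n. P j)"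
    using prod.ub_add_nat[of 1 n P n] by simp
  also have "\<dots> = (\<Prod>j<2*n. P (Suc j))"
    by (rule prod.reindex_bij_witness[of _ Suc "\<lambda>j. j - 1"]) auto
  also have "\<dots> * P N = (\<Prod>j<N. P (Suc j))"
    by (simp add: N_eq)
  also have "\<dots> = qpoch q q"
    using qpoch_split_residues[OF q(1), of N q] N_eq by (simp add: P_def)
  finally show ?thesis by (simp add: P_def n_def)
qed

section \<open>The modular group\<close>

lemma mem_upper_half_plane [simp]: "\<tau> \<in> upper_half_plane \<longleftrightarrow> Im \<tau> > 0"
  by (simp add: upper_half_plane_def)

lemma open_upper_half_plane: "open upper_half_plane"
  unfolding upper_half_plane_def by (rule open_halfspace_Im_gt)

lemma connected_upper_half_plane: "connected upper_half_plane"
  unfolding upper_half_plane_def by (intro convex_connected convex_halfspace_Im_gt)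

definition mat2 :: "int \<Rightarrow> int \<Rightarrow> int \<Rightarrow> int \<Rightarrow> int ^ 2 ^ 2" where
  "mat2 a b c d = vector [vector [a, b], vector [c, d]]"

lemma mat2_nth [simp]:
  "mat2 a b c d $ 1 $ 1 = a" "mat2 a b c d $ 1 $ 2 = b"
  "mat2 a b c d $ 2 $ 1 = c" "mat2 a b c d $ 2 $ 2 = d"
  by (simp_all add: mat2_def)

lemma mat2_in_SL2Z_iff: "mat2 a b c d \<in> SL2Z \<longleftrightarrow> a * d - b * c = 1"
  by (simp add: SL2Z_def det_2)

lemma SL2Z_cases [case_names mat2, cases set: SL2Z]:
  assumes "A \<in> SL2Z"
  obtains a b c d where "A = mat2 a b c d" "a * d - b * c = 1"
proof -
  have "A = mat2 (A $ 1 $ 1) (A $ 1 $ 2) (A $ 2 $ 1) (A $ 2 $ 2)"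
    by (simp add: vec_eq_iff forall_2)
  then show ?thesis
    using assms mat2_in_SL2Z_iff that by metis
qed

lemma of_int_det_eq_1:
  assumes "a * d - b * c = 1"
  shows "of_int a * of_int d - of_int b * of_int c = (1 :: complex)"
  using assms by (metis of_int_1 of_int_diff of_int_mult)

definition automorphy_factor :: "int ^ 2 ^ 2 \<Rightarrow> complex \<Rightarrow> complex" where
  "automorphy_factor A \<tau> = of_int (A $ 2 $ 1) * \<tau> + of_int (A $ 2 $ 2)"

lemma automorphy_factor_mat2 [simp]: "automorphy_factor (mat2 a b c d) \<tau> = of_int c * \<tau> + of_int d"
  by (simp add: automorphy_factor_def)

lemma moebius_act_mat2:
  "moebius_act (mat2 a b c d) \<tau> = (of_int a * \<tau> + of_int b) / (of_int c * \<tau> + of_int d)"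
  by (simp add: moebius_act_def)

lemma automorphy_factor_nonzero:
  assumes "A \<in> SL2Z" "Im \<tau> > 0"
  shows "automorphy_factor A \<tau> \<noteq> 0"
  using assms(1)
proof (cases A rule: SL2Z_cases)
  case (mat2 a b c d)
  have "c \<noteq> 0 \<or> of_int d \<noteq> (0 :: complex)"
    using mat2(2) by auto
  then show ?thesis
    using mat2(1) assms(2) by (auto simp: complex_eq_iff)
qed

lemma Im_moebius_act_pos:
  assumes A: "A \<in> SL2Z" and \<tau>: "Im \<tau> > 0"
  shows "Im (moebius_act A \<tau>) > 0"
  using A
proof (cases A rule: SL2Z_cases)
  case (mat2 a b c d)
  define J where "J = of_int c * \<tau> + of_int d"
  have "J \<noteq> 0"
    using automorphy_factor_nonzero[OF A \<tau>] mat2(1) by (simp add: J_def)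
  have "Im (moebius_act A \<tau>) = of_int (a * d - b * c) * Im \<tau> / ((Re J)\<^sup>2 + (Im J)\<^sup>2)"
    unfolding mat2(1) moebius_act_mat2 Im_divide by (simp add: J_def algebra_simps)
  also have "\<dots> > 0"
    using \<open>J \<noteq> 0\<close> mat2(2) \<tau> by (auto simp: complex_neq_0)
  finally show ?thesis .
qed

section \<open>The theta function\<close>

definition expi :: "complex \<Rightarrow> complex" where
  "expi x = exp (of_real pi * \<i> * x)"

lemma expi_add: "expi (x + y) = expi x * expi y"
  by (simp add: expi_def exp_add ring_distribs)

lemma expi_diff: "expi (x - y) = expi x / expi y"
  by (simp add: expi_def exp_diff ring_distribs)

lemma expi_minus: "expi (- x) = inverse (expi x)"
  by (simp add: expi_def exp_minus)

lemma expi_nonzero [simp]: "expi x \<noteq> 0"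
  by (simp add: expi_def)

lemma expi_0 [simp]: "expi 0 = 1"
  by (simp add: expi_def)

lemma expi_1 [simp]: "expi 1 = - 1"
  by (simp add: expi_def)

lemma expi_mult_of_nat: "expi (of_nat n * x) = expi x ^ n"
  by (simp add: expi_def mult.left_commute flip: exp_of_nat_mult)

lemma expi_mult_of_int: "expi (of_int n * x) = expi x powi n"
  by (simp add: expi_def exp_power_int mult.left_commute)

lemma expi_sum: "finite I \<Longrightarrow> expi (\<Sum>j\<in>I. f j) = (\<Prod>j\<in>I. expi (f j))"
  by (simp add: expi_def exp_sum sum_distrib_left)

lemma expi_eq_1_iff: "expi x = 1 \<longleftrightarrow> (\<exists>n::int. x = 2 * of_int n)"
  unfolding expi_def exp_eq_1
proof safe
  fix n :: int
  assume "Re (of_real pi * \<i> * x) = 0" and "Im (of_real pi * \<i> * x) = of_int (2 * n) * pi"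
  then show "\<exists>n. x = 2 * of_int n"
    by (intro exI[of _ n]) (auto simp: complex_eq_iff)
qed auto

lemma expi_of_int: "expi (of_int n) = (if even n then 1 else - 1)"
  using expi_mult_of_int[of n 1] by (simp add: power_int_minus_left)

lemma norm_expi: "norm (expi x) = exp (- pi * Im x)"
  by (simp add: expi_def)

lemma norm_expi_less_1: "Im x > 0 \<Longrightarrow> norm (expi x) < 1"
  by (simp add: norm_expi)

lemma holomorphic_on_expi [holomorphic_intros]:
  "f holomorphic_on S \<Longrightarrow> (\<lambda>z. expi (f z)) holomorphic_on S"
  unfolding expi_def by (intro holomorphic_intros)

definition lattice_vector :: "complex \<Rightarrow> int \<Rightarrow> int \<Rightarrow> complex" where
  "lattice_vector \<tau> m n = of_int m * \<tau> + of_int n"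

lemma lattice_vector_moebius_act:
  assumes "A = mat2 a b c d" "a * d - b * c = 1" "Im \<tau> > 0"
  shows "lattice_vector \<tau> m n / automorphy_factor A \<tau> =
    lattice_vector (moebius_act A \<tau>) (d * m - c * n) (a * n - b * m)"
proof -
  have "A \<in> SL2Z" using assms by (simp add: mat2_in_SL2Z_iff)
  then have J: "of_int c * \<tau> + of_int d \<noteq> 0"
    using automorphy_factor_nonzero assms by fastforce
  have "of_int (d * m - c * n) * (of_int a * \<tau> + of_int b) +
      of_int (a * n - b * m) * (of_int c * \<tau> + of_int d) =
      (of_int a * of_int d - of_int b * of_int c) * lattice_vector \<tau> m n"
    by (simp add: lattice_vector_def algebra_simps)
  then show ?thesis
    using J unfolding of_int_det_eq_1[OF assms(2)]
    by (simp add: assms(1) moebius_act_mat2 lattice_vector_def field_simps)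
qed

lemma doubly_periodic_entire_constant:
  assumes \<tau>: "Im \<tau> > 0" and hol: "F holomorphic_on UNIV"
    and periodic: "\<And>m n z. F (z + lattice_vector \<tau> m n) = F z"
  shows "F constant_on UNIV"
proof -
  define K where "K = (\<lambda>(s, t). of_real s * \<tau> + of_real t) ` ({0..1::real} \<times> {0..1::real})"
  have "compact K"
    unfolding K_def case_prod_unfold
    by (intro compact_continuous_image compact_Times continuous_intros compact_Icc)
  then have "bounded (F ` K)"
    using holomorphic_on_imp_continuous_on[OF hol]
    by (intro compact_imp_bounded compact_continuous_image) (auto intro: continuous_on_subset)
  moreover have "range F \<subseteq> F ` K"
  proof safe
    fix z
    define s where "s = Im z / Im \<tau>"
    define t where "t = Re z - s * Re \<tau>"
    have z: "z = of_real s * \<tau> + of_real t"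
      using \<tau> by (simp add: complex_eq_iff s_def t_def)
    have "F z = F (z + lattice_vector \<tau> (- \<lfloor>s\<rfloor>) (- \<lfloor>t\<rfloor>))"
      by (rule periodic[symmetric])
    also have "z + lattice_vector \<tau> (- \<lfloor>s\<rfloor>) (- \<lfloor>t\<rfloor>) = of_real (frac s) * \<tau> + of_real (frac t)"
      by (subst z) (simp add: lattice_vector_def frac_def algebra_simps)
    finally have "F z = F (of_real (frac s) * \<tau> + of_real (frac t))" .
    moreover have "of_real (frac s) * \<tau> + of_real (frac t) \<in> K"
      unfolding K_def by (rule image_eqI[of _ _ "(frac s, frac t)"])
        (auto simp: less_imp_le[OF frac_lt_1])
    ultimately show "F z \<in> F ` K" by blast
  qed
  ultimately show ?thesis
    using Liouville_theorem[OF hol] bounded_subset by blast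
qed

text \<open>Since \<open>x / 0 = 0\<close>, the quotient \<open>H / D\<close> is already continuous at the lattice points, so it is
  entire without any redefinition.\<close>

lemma quasi_periodic_double_zero_imp_zero:
  assumes \<tau>: "Im \<tau> > 0"
    and H: "H holomorphic_on UNIV" and D: "D holomorphic_on UNIV"
    and H_shift: "\<And>m n z. H (z + lattice_vector \<tau> m n) = \<mu> m n z * H z"
    and D_shift: "\<And>m n z. D (z + lattice_vector \<tau> m n) = \<mu> m n z * D z"
    and \<mu>: "\<And>m n z. \<mu> m n z \<noteq> 0"
    and D_zeros: "\<And>z. D z = 0 \<Longrightarrow> \<exists>m n. z = lattice_vector \<tau> m n"
    and H_0: "H 0 = 0" "(H has_field_derivative 0) (at 0)"
    and D_0: "D 0 = 0" "(D has_field_derivative d) (at 0)" "d \<noteq> 0"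
  shows "H z = 0"
proof -
  define F where "F = (\<lambda>z. H z / D z)"
  have F_0: "F 0 = 0" by (simp add: F_def D_0)
  have F_shift: "F (z + lattice_vector \<tau> m n) = F z" for m n z
    using \<mu> by (simp add: F_def H_shift D_shift)
  have "F \<midarrow>0\<rightarrow> F 0"
    unfolding F_def using H_0 D_0 by (intro lhopital_complex_simple[of H 0 0 D d]) auto
  then have F_cont: "isCont F (lattice_vector \<tau> m n)" for m n
    using F_shift[of _ m n] F_shift[of 0 m n] by (simp add: isCont_iff add.commute)
  have HD: "H analytic_on {z}" "D analytic_on {z}" for z
    using H D analytic_on_subset[OF _ subset_UNIV] by (auto simp: analytic_on_open)
  have "F analytic_on {z}" for z
  proof (cases "D z = 0")
    case False
    then show ?thesis unfolding F_def by (intro analytic_intros HD) auto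
  next
    case True
    then obtain m n where "z = lattice_vector \<tau> m n" using D_zeros by blast
    moreover have "F meromorphic_on {z}"
      unfolding F_def by (intro meromorphic_intros analytic_on_imp_meromorphic_on HD)
    ultimately show ?thesis using F_cont by (intro meromorphic_at_isCont_imp_analytic) auto
  qed
  then have "F holomorphic_on UNIV"
    using analytic_imp_holomorphic analytic_on_analytic_at by blast
  then have "F z = F 0"
    using doubly_periodic_entire_constant[OF \<tau> _ F_shift] by (auto simp: constant_on_def)
  then consider (lattice_point) "D z = 0" | (zero) "H z = 0" using F_0 by (auto simp: F_def)
  then show ?thesis
  proof cases
    case lattice_point
    then obtain m n where "z = lattice_vector \<tau> m n" using D_zeros by blast
    then show ?thesis using H_shift[of 0 m n] H_0 by simp
  qed
qed

lemma quasi_periodic_proportional: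
  assumes \<tau>: "Im \<tau> > 0"
    and N: "N holomorphic_on UNIV" and D: "D holomorphic_on UNIV"
    and N_shift: "\<And>m n z. N (z + lattice_vector \<tau> m n) = \<mu> m n z * N z"
    and D_shift: "\<And>m n z. D (z + lattice_vector \<tau> m n) = \<mu> m n z * D z"
    and \<mu>: "\<And>m n z. \<mu> m n z \<noteq> 0"
    and D_zeros: "\<And>z. D z = 0 \<Longrightarrow> \<exists>m n. z = lattice_vector \<tau> m n"
    and N_0: "N 0 = 0" "(N has_field_derivative e) (at 0)"
    and D_0: "D 0 = 0" "(D has_field_derivative d) (at 0)" "d \<noteq> 0"
  shows "N z = e / d * D z"
proof -
  have "N z - e / d * D z = 0"
  proof (rule quasi_periodic_double_zero_imp_zero[where H = "\<lambda>z. N z - e / d * D z",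
      OF \<tau> _ D _ D_shift \<mu> D_zeros _ _ D_0])
    show "(\<lambda>z. N z - e / d * D z) holomorphic_on UNIV"
      by (intro holomorphic_intros N D)
    show "N (z + lattice_vector \<tau> m n) - e / d * D (z + lattice_vector \<tau> m n) =
        \<mu> m n z * (N z - e / d * D z)" for m n z
      unfolding N_shift D_shift by (simp add: algebra_simps)
    show "((\<lambda>z. N z - e / d * D z) has_field_derivative 0) (at 0)"
      using DERIV_diff[OF N_0(2) DERIV_cmult[OF D_0(2), of "e / d"]] D_0(3) by simp
  qed (simp_all add: N_0 D_0)
  then show ?thesis by simp
qed

definition theta :: "complex \<Rightarrow> complex \<Rightarrow> complex" where
  "theta z \<tau> = - expi (- z) * qtheta (expi (2 * z)) (expi (2 * \<tau>)) /
     (2 * of_real pi * \<i> * qpoch (expi (2 * \<tau>)) (expi (2 * \<tau>)) ^ 2)"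

lemma norm_nome_less_1: "Im \<tau> > 0 \<Longrightarrow> norm (expi (2 * \<tau>)) < 1"
  by (intro norm_expi_less_1) simp

lemma theta_0 [simp]: "Im \<tau> > 0 \<Longrightarrow> theta 0 \<tau> = 0"
  using qpoch_rec[of "expi (2 * \<tau>)" 1] by (simp add: theta_def qtheta_def norm_nome_less_1)

lemma theta_add_1: "theta (z + 1) \<tau> = - theta z \<tau>"
proof -
  have "expi (2 * (z + 1)) = expi (2 * z)" "expi (- (z + 1)) = - expi (- z)"
    using expi_of_int[of 2] by (simp_all add: ring_distribs expi_add expi_diff)
  then show ?thesis unfolding theta_def by simp
qed

lemma theta_add_tau:
  assumes "Im \<tau> > 0"
  shows "theta (z + \<tau>) \<tau> = - expi (- 2 * z - \<tau>) * theta z \<tau>"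
proof -
  define q where "q = expi (2 * \<tau>)"
  define x where "x = expi (2 * z)"
  have "norm q < 1" "q \<noteq> 0" "x \<noteq> 0"
    using assms by (simp_all add: q_def x_def norm_nome_less_1)
  then have "qtheta (x * q) q = - (1 / x) * qtheta x q"
    by (rule qtheta_mult_q)
  moreover have "expi (2 * (z + \<tau>)) = x * q" "expi (- (z + \<tau>)) = expi (- z) * expi (- \<tau>)"
    "expi (- 2 * z - \<tau>) = expi (- \<tau>) / x"
    by (simp_all add: x_def q_def ring_distribs expi_add expi_diff expi_minus field_simps)
  ultimately show ?thesis
    by (simp add: theta_def flip: q_def x_def)
qed

lemma int_induct_iff [case_names zero step]:
  fixes i :: int
  assumes "P 0" and "\<And>j. P j \<longleftrightarrow> P (j + 1)"
  shows "P i"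
proof (induction i rule: int_induct[where k = 0])
  case base
  show ?case by (rule assms(1))
next
  case (step1 i)
  then show ?case using assms(2) by blast
next
  case (step2 i)
  then show ?case using assms(2)[of "i - 1"] by simp
qed

lemma theta_add_lattice:
  assumes \<tau>: "Im \<tau> > 0"
  shows "theta (z + lattice_vector \<tau> m n) \<tau> =
    expi (of_int (m + n + m * n) - of_int m * (2 * z + lattice_vector \<tau> m n)) * theta z \<tau>"
proof -
  have add_int: "theta (z + of_int n) \<tau> = expi (of_int n) * theta z \<tau>" for z
  proof (induction n rule: int_induct_iff)
    case (step j)
    show ?case
      using theta_add_1[of "z + of_int j" \<tau>] by (simp add: expi_add add.assoc)
  qed simp
  have add_mult_tau: "theta (z + of_int m * \<tau>) \<tau> =
      expi (of_int m - of_int m * (2 * z + of_int m * \<tau>)) * theta z \<tau>"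
  proof (induction m rule: int_induct_iff)
    case (step j)
    define u where "u = - 2 * (z + of_int j * \<tau>) - \<tau>"
    define v where "v = of_int j - of_int j * (2 * z + of_int j * \<tau>)"
    have "theta (z + of_int (j + 1) * \<tau>) \<tau> = - expi u * theta (z + of_int j * \<tau>) \<tau>"
      using theta_add_tau[OF \<tau>, of "z + of_int j * \<tau>"] by (simp add: u_def algebra_simps)
    moreover have exponent: "of_int (j + 1) - of_int (j + 1) * (2 * z + of_int (j + 1) * \<tau>) = u + v + 1"
      by (simp add: u_def v_def algebra_simps)
    have "expi (of_int (j + 1) - of_int (j + 1) * (2 * z + of_int (j + 1) * \<tau>)) = - expi u * expi v"
      unfolding exponent by (simp add: expi_add)
    ultimately show ?case by (simp flip: v_def)
  qed simp
  have "theta (z + lattice_vector \<tau> m n) \<tau> =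
      expi (of_int n + (of_int m - of_int m * (2 * z + of_int m * \<tau>))) * theta z \<tau>"
    using add_int[of "z + of_int m * \<tau>"]
    by (simp add: lattice_vector_def add.assoc add_mult_tau expi_add)
  also have "of_int n + (of_int m - of_int m * (2 * z + of_int m * \<tau>)) =
      of_int (m + n + m * n) - of_int m * (2 * z + lattice_vector \<tau> m n)"
    by (simp add: lattice_vector_def algebra_simps)
  finally show ?thesis .
qed

lemma theta_eq_0D:
  assumes "Im \<tau> > 0" "theta z \<tau> = 0"
  shows "\<exists>m n. z = lattice_vector \<tau> m n"
proof -
  have q: "norm (expi (2 * \<tau>)) < 1" using assms(1) by (rule norm_nome_less_1)
  then have "qtheta (expi (2 * z)) (expi (2 * \<tau>)) = 0"
    using assms(2) qpoch_nonzero[OF q q] by (simp add: theta_def)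
  then obtain m where "expi (2 * z) = expi (2 * \<tau>) powi m"
    using qtheta_eq_0_iff[OF q, of "expi (2 * z)"] by auto
  then have "expi (2 * z - of_int m * (2 * \<tau>)) = 1"
    by (simp add: expi_diff expi_mult_of_int)
  then obtain n where "2 * z - of_int m * (2 * \<tau>) = 2 * of_int n"
    unfolding expi_eq_1_iff by blast
  then have "z = lattice_vector \<tau> m n"
    by (simp add: lattice_vector_def algebra_simps complex_eq_iff)
  then show ?thesis by blast
qed

lemma holomorphic_on_theta [holomorphic_intros]:
  assumes "Im \<tau> > 0" and "open S" and "f holomorphic_on S"
  shows "(\<lambda>z. theta (f z) \<tau>) holomorphic_on S"
proof -
  have q: "norm (expi (2 * \<tau>)) < 1" using assms(1) by (rule norm_nome_less_1)
  show ?thesis unfolding theta_def qtheta_def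
    using qpoch_nonzero[OF q q] q by (intro holomorphic_intros assms) auto
qed

lemma has_field_derivative_theta_0:
  assumes "Im \<tau> > 0"
  shows "((\<lambda>z. theta z \<tau>) has_field_derivative 1) (at 0)"
proof -
  define q where "q = expi (2 * \<tau>)"
  have q: "norm q < 1" unfolding q_def using assms by (rule norm_nome_less_1)
  define H where "H = (\<lambda>z. - expi (- z) * qpoch (expi (2 * z) * q) q * qpoch (q / expi (2 * z)) q /
     (2 * of_real pi * \<i> * qpoch q q ^ 2))"
  have theta_eq: "theta z \<tau> = (1 - expi (2 * z)) * H z" for z
    unfolding theta_def H_def q_def[symmetric] qtheta_def qpoch_rec[OF q, of "expi (2 * z)"] by simp
  have "H holomorphic_on UNIV"
    unfolding H_def using q qpoch_nonzero[OF q q] by (intro holomorphic_intros) auto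
  then obtain h where h: "(H has_field_derivative h) (at 0)"
    unfolding holomorphic_on_def field_differentiable_def by auto
  have "H 0 = - 1 / (2 * of_real pi * \<i>)"
    using qpoch_nonzero[OF q q] by (simp add: H_def power2_eq_square)
  moreover have "((\<lambda>z. 1 - expi (2 * z)) has_field_derivative - (2 * of_real pi * \<i>)) (at 0)"
    unfolding expi_def by (auto intro!: derivative_eq_intros)
  ultimately show ?thesis
    using DERIV_mult[OF _ h, of "\<lambda>z. 1 - expi (2 * z)"] by (fastforce simp: theta_eq)
qed

lemma expi_lattice_character_SL2Z:
  assumes "a * d - b * c = 1"
  shows "expi (of_int ((d * m - c * n) + (a * n - b * m) + (d * m - c * n) * (a * n - b * m))) =
    expi (of_int (m + n + m * n))"
proof -
  have "odd (a * d - b * c)" using assms by simp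
  then show ?thesis
    unfolding expi_of_int
    by (cases "even a"; cases "even b"; cases "even c"; cases "even d") auto
qed

definition twisted_theta :: "int ^ 2 ^ 2 \<Rightarrow> complex \<Rightarrow> complex \<Rightarrow> complex" where
  "twisted_theta A \<tau> z = expi (- of_int (A $ 2 $ 1) * z\<^sup>2 / automorphy_factor A \<tau>) *
     theta (z / automorphy_factor A \<tau>) (moebius_act A \<tau>)"

lemma twisted_theta_add_lattice:
  fixes m n :: int
  assumes A: "A \<in> SL2Z" and \<tau>: "Im \<tau> > 0"
  defines "w \<equiv> lattice_vector \<tau> m n"
  shows "twisted_theta A \<tau> (z + w) =
    expi (of_int (m + n + m * n) - of_int m * (2 * z + w)) * twisted_theta A \<tau> z"
proof -
  obtain a b c d where A_eq: "A = mat2 a b c d" and det: "a * d - b * c = 1"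
    using A by (rule SL2Z_cases)
  define J t where "J = automorphy_factor A \<tau>" and "t = moebius_act A \<tau>"
  define m' n' where "m' = d * m - c * n" and "n' = a * n - b * m"
  define \<epsilon> :: complex where "\<epsilon> = of_int (m + n + m * n)"
  have J: "J \<noteq> 0" unfolding J_def by (rule automorphy_factor_nonzero[OF A \<tau>])
  have t: "Im t > 0" unfolding t_def by (rule Im_moebius_act_pos[OF A \<tau>])
  have twisted_eq: "twisted_theta A \<tau> z = expi (- of_int c * z\<^sup>2 / J) * theta (z / J) t" for z
    by (simp add: twisted_theta_def A_eq J_def t_def)
  have w: "w / J = lattice_vector t m' n'"
    unfolding w_def J_def t_def m'_def n'_def by (rule lattice_vector_moebius_act[OF A_eq det \<tau>])
  have character: "expi (of_int (m' + n' + m' * n')) = expi \<epsilon>"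
    unfolding m'_def n'_def \<epsilon>_def by (rule expi_lattice_character_SL2Z[OF det])
  have "of_int c * w + of_int m' = of_int m * J"
    by (simp add: w_def lattice_vector_def m'_def J_def A_eq algebra_simps)
  then have "(2 * z + w) * (of_int c * w + of_int m') / J = of_int m * (2 * z + w)"
    using J by simp
  moreover have "- of_int c * (z + w)\<^sup>2 / J - of_int m' * (2 * (z / J) + w / J) =
      - of_int c * z\<^sup>2 / J - (2 * z + w) * (of_int c * w + of_int m') / J"
    using J by (simp add: field_simps power2_eq_square)
  ultimately have exponent:
    "- of_int c * (z + w)\<^sup>2 / J + (\<epsilon> - of_int m' * (2 * (z / J) + w / J)) =
      \<epsilon> - of_int m * (2 * z + w) + - of_int c * z\<^sup>2 / J"
    by (simp add: algebra_simps)
  have "twisted_theta A \<tau> (z + w) =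
      expi (- of_int c * (z + w)\<^sup>2 / J) * theta (z / J + lattice_vector t m' n') t"
    by (simp add: twisted_eq add_divide_distrib w)
  also have "\<dots> =
      expi (- of_int c * (z + w)\<^sup>2 / J + (\<epsilon> - of_int m' * (2 * (z / J) + w / J))) * theta (z / J) t"
    unfolding theta_add_lattice[OF t] w expi_add expi_diff character by simp
  also have "\<dots> = expi (\<epsilon> - of_int m * (2 * z + w)) * twisted_theta A \<tau> z"
    unfolding exponent expi_add by (simp add: twisted_eq)
  finally show ?thesis unfolding \<epsilon>_def .
qed

lemma holomorphic_on_twisted_theta:
  assumes "A \<in> SL2Z" "Im \<tau> > 0"
  shows "twisted_theta A \<tau> holomorphic_on UNIV"
  unfolding twisted_theta_def
  using automorphy_factor_nonzero[OF assms] Im_moebius_act_pos[OF assms]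
  by (intro holomorphic_intros) auto

lemma has_field_derivative_twisted_theta_0:
  assumes "A \<in> SL2Z" "Im \<tau> > 0"
  shows "(twisted_theta A \<tau> has_field_derivative 1 / automorphy_factor A \<tau>) (at 0)"
proof -
  define c J t where "c = complex_of_int (A $ 2 $ 1)" and "J = automorphy_factor A \<tau>"
    and "t = moebius_act A \<tau>"
  have J: "J \<noteq> 0" unfolding J_def by (rule automorphy_factor_nonzero[OF assms])
  have t: "Im t > 0" unfolding t_def by (rule Im_moebius_act_pos[OF assms])
  have "(\<lambda>z. expi (- c * z\<^sup>2 / J)) holomorphic_on UNIV"
    using J by (intro holomorphic_intros) auto
  then obtain e where "((\<lambda>z. expi (- c * z\<^sup>2 / J)) has_field_derivative e) (at 0)"
    unfolding holomorphic_on_def field_differentiable_def by auto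
  moreover have "((\<lambda>z. theta (z / J) t) has_field_derivative 1 * (1 / J)) (at 0)"
  proof (rule DERIV_chain2[where f = "\<lambda>z. theta z t"])
    show "((\<lambda>z. z / J) has_field_derivative 1 / J) (at 0)"
      using J by (auto intro!: derivative_eq_intros)
  qed (use has_field_derivative_theta_0[OF t] in simp)
  ultimately have "((\<lambda>z. expi (- c * z\<^sup>2 / J) * theta (z / J) t) has_field_derivative
      e * theta (0 / J) t + 1 * (1 / J) * expi (- c * 0\<^sup>2 / J)) (at 0)"
    by (rule DERIV_mult)
  moreover have "twisted_theta A \<tau> = (\<lambda>z. expi (- c * z\<^sup>2 / J) * theta (z / J) t)"
    by (simp add: fun_eq_iff twisted_theta_def c_def J_def t_def)
  ultimately show ?thesis using t by (simp add: J_def)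
qed

lemma theta_moebius_act:
  fixes A :: "int ^ 2 ^ 2"
  assumes A: "A \<in> SL2Z" and \<tau>: "Im \<tau> > 0"
  defines "J \<equiv> automorphy_factor A \<tau>"
  shows "theta (z / J) (moebius_act A \<tau>) = expi (of_int (A $ 2 $ 1) * z\<^sup>2 / J) / J * theta z \<tau>"
proof -
  have "twisted_theta A \<tau> z = (1 / J) / 1 * theta z \<tau>"
    unfolding J_def
  proof (rule quasi_periodic_proportional[where D = "\<lambda>z. theta z \<tau>", OF \<tau> _ _
        twisted_theta_add_lattice[OF A \<tau>] theta_add_lattice[OF \<tau>]])
    show "twisted_theta A \<tau> 0 = 0"
      using Im_moebius_act_pos[OF A \<tau>] by (simp add: twisted_theta_def)
    show "(\<lambda>z. theta z \<tau>) holomorphic_on UNIV"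
      using \<tau> by (intro holomorphic_intros) auto
  qed (use \<tau> theta_eq_0D in \<open>simp_all add: holomorphic_on_twisted_theta[OF A]
         has_field_derivative_twisted_theta_0[OF A]
         has_field_derivative_theta_0\<close>)
  then show ?thesis
    by (simp add: twisted_theta_def J_def expi_minus field_simps)
qed

section \<open>Klein forms, Siegel functions and the eta function\<close>

definition klein :: "complex \<Rightarrow> complex \<Rightarrow> complex \<Rightarrow> complex" where
  "klein x y \<tau> = expi (x * (x * \<tau> + y)) * theta (x * \<tau> + y) \<tau>"

lemma klein_add_int:
  fixes m n :: int
  assumes "Im \<tau> > 0"
  shows "klein (x + of_int m) (y + of_int n) \<tau> =
    expi (of_int (m + n + m * n) + (x * of_int n - of_int m * y)) * klein x y \<tau>"
proof -
  define z where "z = x * \<tau> + y"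
  define w where "w = lattice_vector \<tau> m n"
  have arg: "(x + of_int m) * \<tau> + (y + of_int n) = z + w"
    by (simp add: z_def w_def lattice_vector_def algebra_simps)
  have exponent: "(x + of_int m) * (z + w) + (of_int (m + n + m * n) - of_int m * (2 * z + w)) =
      of_int (m + n + m * n) + (x * of_int n - of_int m * y) + x * z"
    by (simp add: z_def w_def lattice_vector_def algebra_simps)
  show ?thesis
    unfolding klein_def arg w_def theta_add_lattice[OF assms]
    unfolding w_def[symmetric] z_def[symmetric] mult.assoc[symmetric] expi_add[symmetric] exponent ..
qed

lemma klein_moebius_act:
  assumes det: "a * d - b * c = 1" and \<tau>: "Im \<tau> > 0"
  defines "A \<equiv> mat2 a b c d"
  shows "klein x y (moebius_act A \<tau>) =
    klein (x * of_int a + y * of_int c) (x * of_int b + y * of_int d) \<tau> / automorphy_factor A \<tau>"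
proof -
  have A: "A \<in> SL2Z" using det by (simp add: A_def mat2_in_SL2Z_iff)
  define J where "J = automorphy_factor A \<tau>"
  define x' y' z where "x' = x * of_int a + y * of_int c" and "y' = x * of_int b + y * of_int d"
    and "z = x' * \<tau> + y'"
  have J: "J \<noteq> 0" unfolding J_def by (rule automorphy_factor_nonzero[OF A \<tau>])
  have J_eq: "J = of_int c * \<tau> + of_int d" by (simp add: J_def A_def)
  have arg: "x * moebius_act A \<tau> + y = z / J"
    using J by (simp add: A_def moebius_act_mat2 J_eq x'_def y'_def z_def field_simps)
  have "x + of_int c * z = x * (of_int a * of_int d - of_int b * of_int c) + of_int c * z"
    unfolding of_int_det_eq_1[OF det] by simp
  also have "\<dots> = x' * J"
    by (simp add: J_eq x'_def y'_def z_def algebra_simps)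
  finally have "z * (x + of_int c * z) / J = x' * z"
    using J by simp
  then have exponent: "x * (z / J) + of_int c * z\<^sup>2 / J = x' * z"
    by (simp add: add_divide_distrib power2_eq_square algebra_simps)
  have "klein x y (moebius_act A \<tau>) = expi (x * (z / J)) * (expi (of_int c * z\<^sup>2 / J) / J * theta z \<tau>)"
    unfolding klein_def arg using theta_moebius_act[OF A \<tau>, of z] by (simp add: J_def A_def)
  also have "\<dots> = expi (x * (z / J) + of_int c * z\<^sup>2 / J) * theta z \<tau> / J"
    by (simp add: expi_add)
  also have "\<dots> = klein x' y' \<tau> / J"
    unfolding exponent by (simp add: klein_def z_def)
  finally show ?thesis unfolding x'_def y'_def J_def .
qed

lemma dedekind_eta_eq_qpoch:
  "dedekind_eta \<tau> = expi (\<tau> / 12) * qpoch (expi (2 * \<tau>)) (expi (2 * \<tau>))"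
proof -
  have "exp (2 * of_real pi * \<i> * \<tau>) = expi (2 * \<tau>)" "exp (2 * of_real pi * \<i> * \<tau> / 24) = expi (\<tau> / 12)"
    by (simp_all add: expi_def mult_ac)
  then show ?thesis by (simp add: dedekind_eta_def qpoch_def)
qed

lemma dedekind_eta_nonzero:
  assumes "Im \<tau> > 0"
  shows "dedekind_eta \<tau> \<noteq> 0"
  using norm_nome_less_1[OF assms] qpoch_nonzero by (simp add: dedekind_eta_eq_qpoch)

lemma holomorphic_on_dedekind_eta:
  assumes "f holomorphic_on S" "open S" "\<And>z. z \<in> S \<Longrightarrow> Im (f z) > 0"
  shows "(\<lambda>z. dedekind_eta (f z)) holomorphic_on S"
  unfolding dedekind_eta_eq_qpoch
  using assms norm_nome_less_1 by (intro holomorphic_intros) auto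

lemma dedekind_eta_add_int: "dedekind_eta (\<tau> + of_int n) = expi (of_int n / 12) * dedekind_eta \<tau>"
proof -
  have "expi (2 * (\<tau> + of_int n)) = expi (2 * \<tau>)"
    using expi_of_int[of "2 * n"] by (simp add: ring_distribs expi_add)
  then show ?thesis by (simp add: dedekind_eta_eq_qpoch add_divide_distrib expi_add)
qed

definition siegel :: "complex \<Rightarrow> complex \<Rightarrow> complex \<Rightarrow> complex" where
  "siegel x y \<tau> = expi ((x - 1) * (x * \<tau> + y) + \<tau> / 6) * qtheta (expi (2 * (x * \<tau> + y))) (expi (2 * \<tau>))"

lemma klein_mult_eta_squared:
  assumes "Im \<tau> > 0"
  shows "klein x y \<tau> * (dedekind_eta \<tau>)\<^sup>2 = - 1 / (2 * of_real pi * \<i>) * siegel x y \<tau>"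
proof -
  define z where "z = x * \<tau> + y"
  define q where "q = expi (2 * \<tau>)"
  have "(x - 1) * z + \<tau> / 6 = x * z + - z + (\<tau> / 12 + \<tau> / 12)"
    by (simp add: algebra_simps)
  then have "siegel x y \<tau> = expi (x * z) * expi (- z) * (expi (\<tau> / 12))\<^sup>2 * qtheta (expi (2 * z)) q"
    unfolding siegel_def z_def[symmetric] q_def[symmetric]
    by (simp only: expi_add power2_eq_square mult_ac)
  moreover have "qpoch q q \<noteq> 0"
    using assms by (simp add: q_def norm_nome_less_1 qpoch_nonzero)
  ultimately show ?thesis
    unfolding klein_def theta_def dedekind_eta_eq_qpoch z_def[symmetric] q_def[symmetric]
    by (simp add: power_mult_distrib mult_ac)
qed

lemma siegel_half_product:
  assumes "Im \<tau> > 0"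
  shows "siegel (1/2) 0 \<tau> * siegel 0 (1/2) \<tau> * siegel (1/2) (1/2) \<tau> = 2 * expi (- 3/4)"
proof -
  define s where "s = expi \<tau>"
  have nome: "expi (2 * \<tau>) = s\<^sup>2"
    using expi_mult_of_nat[of 2 \<tau>] by (simp add: s_def)
  have args: "expi (2 * (1/2 * \<tau> + 0)) = s" "expi (2 * (0 * \<tau> + 1/2)) = - 1"
    "expi (2 * (1/2 * \<tau> + 1/2)) = - s"
    by (simp_all add: s_def ring_distribs expi_add)
  have "siegel (1/2) 0 \<tau> * siegel 0 (1/2) \<tau> * siegel (1/2) (1/2) \<tau> =
      (expi ((1/2 - 1) * (1/2 * \<tau> + 0) + \<tau> / 6) * expi ((0 - 1) * (0 * \<tau> + 1/2) + \<tau> / 6) *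
        expi ((1/2 - 1) * (1/2 * \<tau> + 1/2) + \<tau> / 6)) *
      (qtheta s (s\<^sup>2) * qtheta (- 1) (s\<^sup>2) * qtheta (- s) (s\<^sup>2))"
    unfolding siegel_def args nome by (simp only: mult_ac)
  also have "qtheta s (s\<^sup>2) * qtheta (- 1) (s\<^sup>2) * qtheta (- s) (s\<^sup>2) = 2"
    using assms by (intro qtheta_half_period_product) (simp_all add: s_def norm_expi_less_1)
  also have "expi ((1/2 - 1) * (1/2 * \<tau> + 0) + \<tau> / 6) * expi ((0 - 1) * (0 * \<tau> + 1/2) + \<tau> / 6) *
      expi ((1/2 - 1) * (1/2 * \<tau> + 1/2) + \<tau> / 6) = expi (- 3/4)"
    unfolding expi_add[symmetric] by (rule arg_cong[of _ _ expi]) (simp add: field_simps)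
  finally show ?thesis by simp
qed

lemma klein_half_power4_parity:
  fixes x y :: int
  assumes "Im \<tau> > 0"
  shows "klein (of_int x / 2) (of_int y / 2) \<tau> ^ 4 =
    klein (of_bool (odd x) / 2) (of_bool (odd y) / 2) \<tau> ^ 4"
proof -
  define m n where "m = x div 2" and "n = y div 2"
  have half: "of_int i / 2 = of_bool (odd i) / 2 + (of_int (i div 2) :: complex)" for i :: int
  proof -
    have "of_int i = (of_int (of_bool (odd i) + 2 * (i div 2)) :: complex)"
      by (subst of_int_eq_iff) (auto elim!: oddE)
    then show ?thesis by simp
  qed
  define l where "l = 2 * (m + n + m * n) + (of_bool (odd x) * n - m * of_bool (odd y))"
  have "expi (of_int (m + n + m * n) +
        (of_bool (odd x) / 2 * of_int n - of_int m * (of_bool (odd y) / 2))) ^ 4 =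
      expi (of_int (2 * l))"
    unfolding expi_mult_of_nat[symmetric] l_def by (rule arg_cong[of _ _ expi]) (simp add: algebra_simps)
  also have "\<dots> = 1"
    by (simp only: expi_of_int even_mult_iff) simp
  finally show ?thesis
    unfolding half[of x] half[of y] klein_add_int[OF assms] power_mult_distrib
    by (simp add: m_def n_def)
qed

definition klein_half_product :: "complex \<Rightarrow> complex" where
  "klein_half_product \<tau> = klein (1/2) 0 \<tau> * klein 0 (1/2) \<tau> * klein (1/2) (1/2) \<tau>"

lemma klein_half_product_mult_eta_power6:
  assumes "Im \<tau> > 0"
  shows "klein_half_product \<tau> * dedekind_eta \<tau> ^ 6 =
    (- 1 / (2 * of_real pi * \<i>)) ^ 3 * (2 * expi (- 3/4))"
proof -
  have "klein_half_product \<tau> * dedekind_eta \<tau> ^ 6 =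
      (klein (1/2) 0 \<tau> * (dedekind_eta \<tau>)\<^sup>2) * (klein 0 (1/2) \<tau> * (dedekind_eta \<tau>)\<^sup>2) *
      (klein (1/2) (1/2) \<tau> * (dedekind_eta \<tau>)\<^sup>2)"
    by (simp add: klein_half_product_def eval_nat_numeral)
  also have "\<dots> = (- 1 / (2 * of_real pi * \<i>)) ^ 3 *
      (siegel (1/2) 0 \<tau> * siegel 0 (1/2) \<tau> * siegel (1/2) (1/2) \<tau>)"
    unfolding klein_mult_eta_squared[OF assms] by (simp only: power3_eq_cube mult_ac)
  finally show ?thesis unfolding siegel_half_product[OF assms] .
qed

lemma klein_half_product_moebius_act_power4:
  assumes A: "A \<in> SL2Z" and \<tau>: "Im \<tau> > 0"
  shows "klein_half_product (moebius_act A \<tau>) ^ 4 * automorphy_factor A \<tau> ^ 12 =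
    klein_half_product \<tau> ^ 4"
proof -
  obtain a b c d where A_eq: "A = mat2 a b c d" and det: "a * d - b * c = 1"
    using A by (rule SL2Z_cases)
  define J where "J = automorphy_factor A \<tau>"
  have J: "J \<noteq> 0" unfolding J_def by (rule automorphy_factor_nonzero[OF A \<tau>])
  define K where "K = (\<lambda>x y :: int. klein (of_int x / 2) (of_int y / 2) \<tau> ^ 4)"
  define L where "L = (\<lambda>x y. klein (of_bool x / 2) (of_bool y / 2) \<tau> ^ 4)"
  have K_parity: "K x y = L (odd x) (odd y)" for x y
    unfolding K_def L_def by (rule klein_half_power4_parity[OF \<tau>])
  have "odd (a * d - b * c)" using det by simp
  then have permuted: "K a b * K c d * K (a + c) (b + d) = K 1 0 * K 0 1 * K 1 1"
    unfolding K_parity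
    by (cases "even a"; cases "even b"; cases "even c"; cases "even d") (simp_all add: mult_ac)
  have "klein_half_product (moebius_act A \<tau>) ^ 4 * J ^ 12 =
      (klein (of_int a / 2) (of_int b / 2) \<tau> * klein (of_int c / 2) (of_int d / 2) \<tau> *
        klein (of_int (a + c) / 2) (of_int (b + d) / 2) \<tau> / J ^ 3) ^ 4 * J ^ 12"
    unfolding klein_half_product_def A_eq klein_moebius_act[OF det \<tau>]
    by (simp add: J_def A_eq add_divide_distrib power3_eq_cube)
  also have "\<dots> = K a b * K c d * K (a + c) (b + d)"
    using J by (simp add: K_def power_mult_distrib power_divide flip: power_mult)
  also have "\<dots> = klein_half_product \<tau> ^ 4"
    unfolding permuted by (simp add: K_def klein_half_product_def power_mult_distrib)
  finally show ?thesis unfolding J_def .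
qed

lemma dedekind_eta_power24_moebius_act:
  assumes A: "A \<in> SL2Z" and \<tau>: "Im \<tau> > 0"
  shows "dedekind_eta (moebius_act A \<tau>) ^ 24 = automorphy_factor A \<tau> ^ 12 * dedekind_eta \<tau> ^ 24"
proof -
  define t J where "t = moebius_act A \<tau>" and "J = automorphy_factor A \<tau>"
  define C where "C = (- 1 / (2 * of_real pi * \<i>)) ^ 3 * (2 * expi (- 3/4))"
  have C: "klein_half_product w ^ 4 * dedekind_eta w ^ 24 = C ^ 4" if "Im w > 0" for w
    unfolding C_def klein_half_product_mult_eta_power6[OF that, symmetric]
    by (simp add: power_mult_distrib flip: power_mult)
  have "Im t > 0" unfolding t_def by (rule Im_moebius_act_pos[OF A \<tau>])
  have "klein_half_product t ^ 4 * dedekind_eta t ^ 24 = C ^ 4"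
    using C \<open>Im t > 0\<close> by blast
  also have "\<dots> = klein_half_product t ^ 4 * J ^ 12 * dedekind_eta \<tau> ^ 24"
    unfolding t_def J_def klein_half_product_moebius_act_power4[OF A \<tau>] C[OF \<tau>] ..
  finally have "klein_half_product t ^ 4 * dedekind_eta t ^ 24 =
      klein_half_product t ^ 4 * (J ^ 12 * dedekind_eta \<tau> ^ 24)"
    by (simp only: mult.assoc)
  moreover have "klein_half_product t ^ 4 \<noteq> 0"
    using C[OF \<open>Im t > 0\<close>] by (auto simp: C_def)
  ultimately show ?thesis unfolding t_def J_def by simp
qed

lemma sum_of_nat_upto_half:
  assumes "odd N"
  shows "(\<Sum>j=1..N div 2. of_nat j :: 'a :: field_char_0) = (of_nat N ^ 2 - 1) / 8"
proof -
  have "(\<Sum>j=1..n. of_nat j :: 'a) = (of_nat (2 * n + 1) ^ 2 - 1) / 8" for n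
    by (induction n) (simp_all add: field_simps power2_eq_square)
  from this[of "N div 2"] show ?thesis using assms by simp
qed

lemma sum_of_nat_squares_upto_half:
  assumes "odd N"
  shows "(\<Sum>j=1..N div 2. of_nat j ^ 2 :: 'a :: field_char_0) = of_nat N * (of_nat N ^ 2 - 1) / 24"
proof -
  have "(\<Sum>j=1..n. of_nat j ^ 2 :: 'a) = of_nat (2 * n + 1) * (of_nat (2 * n + 1) ^ 2 - 1) / 24" for n
    by (induction n) (simp_all add: field_simps power2_eq_square)
  from this[of "N div 2"] show ?thesis using assms by simp
qed

lemma sum_siegel_exponents:
  fixes \<tau> :: "'a :: field_char_0"
  assumes N: "odd N"
  shows "(\<Sum>j=1..N div 2. (of_nat j ^ 2 / of_nat N - of_nat j) * \<tau> + of_nat N * \<tau> / 6) =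
    \<tau> / 12 - of_nat N * \<tau> / 12"
proof -
  define n where "n = N div 2"
  have N_eq: "N = 2 * n + 1" using N by (simp add: n_def)
  then have N0: "of_nat N \<noteq> (0 :: 'a)" unfolding of_nat_eq_0_iff by simp
  have n: "of_nat n = ((of_nat N - 1) / 2 :: 'a)" by (simp add: N_eq)
  have "(\<Sum>j=1..n. (of_nat j ^ 2 / of_nat N - of_nat j) * \<tau> + of_nat N * \<tau> / 6) =
      ((\<Sum>j=1..n. of_nat j ^ 2) / of_nat N - (\<Sum>j=1..n. of_nat j)) * \<tau> + of_nat n * (of_nat N * \<tau> / 6)"
    by (simp add: sum.distrib sum_subtractf flip: sum_distrib_right sum_divide_distrib)
  also have "\<dots> = \<tau> / 12 - of_nat N * \<tau> / 12"
    unfolding n sum_of_nat_upto_half[OF N, folded n_def] sum_of_nat_squares_upto_half[OF N, folded n_def]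
    using N0 by (simp add: field_simps power2_eq_square)
  finally show ?thesis by (simp only: n_def)
qed

lemma prod_siegel_eq_eta_quotient:
  assumes \<tau>: "Im \<tau> > 0" and N: "odd N"
  shows "(\<Prod>j=1..N div 2. siegel (of_nat j / of_nat N) 0 (of_nat N * \<tau>)) =
    dedekind_eta \<tau> / dedekind_eta (of_nat N * \<tau>)"
proof -
  define q where "q = expi (2 * \<tau>)"
  have N0: "N \<noteq> 0" using N by (auto elim: oddE)
  have q: "norm q < 1" "q \<noteq> 0" using \<tau> by (simp_all add: q_def norm_nome_less_1)
  then have qN: "norm (q ^ N) < 1" using N0 by (simp add: norm_power power_less_one_iff)
  have nome: "expi (2 * (of_nat j * \<tau>)) = q ^ j" for j
    using expi_mult_of_nat[of j "2 * \<tau>"] by (simp add: q_def mult_ac)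
  define u where "u = (\<lambda>j. (of_nat j ^ 2 / of_nat N - of_nat j) * \<tau> + of_nat N * \<tau> / 6)"
  have "siegel (of_nat j / of_nat N) 0 (of_nat N * \<tau>) = expi (u j) * qtheta (q ^ j) (q ^ N)" for j
  proof -
    have "of_nat j / of_nat N * (of_nat N * \<tau>) + 0 = of_nat j * \<tau>" using N0 by simp
    moreover have "(of_nat j / of_nat N - 1) * (of_nat j * \<tau>) + of_nat N * \<tau> / 6 = u j"
      by (simp add: u_def algebra_simps power2_eq_square)
    ultimately show ?thesis by (simp only: siegel_def nome)
  qed
  then have "(\<Prod>j=1..N div 2. siegel (of_nat j / of_nat N) 0 (of_nat N * \<tau>)) =
      expi (\<Sum>j=1..N div 2. u j) * (\<Prod>j=1..N div 2. qtheta (q ^ j) (q ^ N))"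
    by (simp add: prod.distrib expi_sum)
  also have "(\<Sum>j=1..N div 2. u j) = \<tau> / 12 - of_nat N * \<tau> / 12"
    unfolding u_def by (rule sum_siegel_exponents[OF N])
  also have "(\<Prod>j=1..N div 2. qtheta (q ^ j) (q ^ N)) = qpoch q q / qpoch (q ^ N) (q ^ N)"
    using prod_qtheta_powers[OF q N] qpoch_nonzero[OF qN qN] by (simp add: field_simps)
  also have "expi (\<tau> / 12 - of_nat N * \<tau> / 12) * \<dots> = dedekind_eta \<tau> / dedekind_eta (of_nat N * \<tau>)"
    unfolding dedekind_eta_eq_qpoch nome expi_diff q_def[symmetric] by simp
  finally show ?thesis .
qed

definition klein_product :: "nat \<Rightarrow> complex \<Rightarrow> complex" where
  "klein_product N \<tau> = (\<Prod>j=1..N div 2. klein (of_nat j / of_nat N) 0 (of_nat N * \<tau>))"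

definition eta_quotient :: "nat \<Rightarrow> int \<Rightarrow> int \<Rightarrow> complex \<Rightarrow> complex" where
  "eta_quotient N r s \<tau> = dedekind_eta \<tau> powi r * dedekind_eta (of_nat N * \<tau>) powi s"

lemma eta_quotient_eq_klein_product:
  assumes \<tau>: "Im \<tau> > 0" and N: "odd N"
  shows "eta_quotient N 1 (- int N) \<tau> = (- 2 * of_real pi * \<i>) ^ (N div 2) * klein_product N \<tau>"
proof -
  define y where "y = dedekind_eta (of_nat N * \<tau>)"
  have "N > 0" using N by (rule odd_pos)
  then have N\<tau>: "Im (of_nat N * \<tau>) > 0" using \<tau> by simp
  then have y: "y \<noteq> 0" unfolding y_def by (rule dedekind_eta_nonzero)
  define C where "C = - 2 * of_real pi * \<i>"
  have "siegel x 0 (of_nat N * \<tau>) = C * y\<^sup>2 * klein x 0 (of_nat N * \<tau>)" for x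
    using klein_mult_eta_squared[OF N\<tau>, of x 0] by (simp add: y_def C_def field_simps)
  then have "(\<Prod>j=1..N div 2. siegel (of_nat j / of_nat N) 0 (of_nat N * \<tau>)) =
      (C * y\<^sup>2) ^ (N div 2) * klein_product N \<tau>"
    by (simp add: prod.distrib klein_product_def)
  then have "dedekind_eta \<tau> / y = C ^ (N div 2) * y ^ (2 * (N div 2)) * klein_product N \<tau>"
    unfolding prod_siegel_eq_eta_quotient[OF \<tau> N] y_def[symmetric]
    by (simp add: power_mult_distrib power_mult)
  moreover have "y ^ N = y * y ^ (2 * (N div 2))"
    using N by (metis odd_two_times_div_two_succ power_Suc Suc_eq_plus1)
  ultimately show ?thesis
    unfolding eta_quotient_def y_def[symmetric] C_def[symmetric]
    using y by (simp add: power_int_minus field_simps)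
qed

section \<open>Eta quotients on \<open>\<Gamma>\<^sub>1(N)\<close>\<close>

lemma slash_eq: "slash k f A \<tau> = automorphy_factor A \<tau> powi (- k) * f (moebius_act A \<tau>)"
  by (simp add: slash_def automorphy_factor_def)

lemma slash_cong:
  assumes "\<And>\<tau>. Im \<tau> > 0 \<Longrightarrow> f \<tau> = g \<tau>" "A \<in> SL2Z" "Im \<tau> > 0"
  shows "slash k f A \<tau> = slash k g A \<tau>"
  using assms Im_moebius_act_pos by (simp add: slash_eq)

lemma slash_mult:
  assumes "A \<in> SL2Z" "Im \<tau> > 0"
  shows "slash (k + l) (\<lambda>\<tau>. f \<tau> * g \<tau>) A \<tau> = slash k f A \<tau> * slash l g A \<tau>"
  using automorphy_factor_nonzero[OF assms]
  by (simp add: slash_eq power_int_diff power_int_minus field_simps)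

lemma slash_power_int: "slash (k * n) (\<lambda>\<tau>. f \<tau> powi n) A \<tau> = slash k f A \<tau> powi n"
  by (simp add: slash_eq power_int_mult_distrib flip: power_int_mult)

lemma holomorphic_on_slash:
  assumes A: "A \<in> SL2Z" and f: "f holomorphic_on upper_half_plane"
  shows "slash k f A holomorphic_on upper_half_plane"
proof -
  have J: "automorphy_factor A \<tau> \<noteq> 0" if "\<tau> \<in> upper_half_plane" for \<tau>
    using automorphy_factor_nonzero[OF A] that by simp
  then have "moebius_act A holomorphic_on upper_half_plane"
    unfolding moebius_act_def automorphy_factor_def by (intro holomorphic_intros) auto
  moreover have "moebius_act A ` upper_half_plane \<subseteq> upper_half_plane"
    using Im_moebius_act_pos[OF A] by auto
  ultimately have "(f \<circ> moebius_act A) holomorphic_on upper_half_plane"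
    using f by (intro holomorphic_on_compose_gen)
  then show ?thesis
    unfolding slash_def o_def using J unfolding automorphy_factor_def
    by (intro holomorphic_intros) auto
qed

lemma slash_eta_power24:
  assumes "A \<in> SL2Z" "Im \<tau> > 0"
  shows "slash 12 (\<lambda>\<tau>. dedekind_eta \<tau> ^ 24) A \<tau> = dedekind_eta \<tau> ^ 24"
  using automorphy_factor_nonzero[OF assms] dedekind_eta_power24_moebius_act[OF assms]
  by (simp add: slash_eq power_int_minus)

text \<open>The triangular matrix \<open>(e f; 0 g)\<close> is the Hermite normal form of \<open>diag(e g, 1) A\<close>.\<close>

lemma moebius_act_hermite:
  fixes a b c e f g w :: int and \<tau> :: complex
  assumes A: "A = mat2 a b (e * c) (c * f + g * w)" "A \<in> SL2Z" and g: "g \<noteq> 0"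
  defines "B \<equiv> mat2 (g * a) (e * b - a * f) c w"
    and "\<sigma> \<equiv> (of_int e * \<tau> + of_int f) / of_int g"
  shows "B \<in> SL2Z" and "of_int (e * g) * moebius_act A \<tau> = moebius_act B \<sigma>"
    and "automorphy_factor B \<sigma> = automorphy_factor A \<tau> / of_int g"
proof -
  have "a * (c * f + g * w) - b * (e * c) = 1"
    using A by (simp add: mat2_in_SL2Z_iff)
  then show "B \<in> SL2Z"
    by (simp add: B_def mat2_in_SL2Z_iff algebra_simps)
  have denominator: "of_int c * \<sigma> + of_int w = (of_int (e * c) * \<tau> + of_int (c * f + g * w)) / of_int g"
    using g by (simp add: \<sigma>_def field_simps)
  then show "automorphy_factor B \<sigma> = automorphy_factor A \<tau> / of_int g"
    by (simp add: A(1) B_def)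
  have "of_int (g * a) * \<sigma> + of_int (e * b - a * f) = of_int e * (of_int a * \<tau> + of_int b)"
    using g by (simp add: \<sigma>_def field_simps)
  then show "of_int (e * g) * moebius_act A \<tau> = moebius_act B \<sigma>"
    unfolding A(1) B_def moebius_act_mat2 denominator by simp
qed

lemma moebius_act_mult_level:
  assumes "A = mat2 a b (int N * c) d" "A \<in> SL2Z"
  defines "B \<equiv> mat2 a (int N * b) c d"
  shows "B \<in> SL2Z" and "of_nat N * moebius_act A \<tau> = moebius_act B (of_nat N * \<tau>)"
    and "automorphy_factor B (of_nat N * \<tau>) = automorphy_factor A \<tau>"
  using assms moebius_act_hermite(1)[of A a b "int N" c 0 1 d]
    moebius_act_hermite(2,3)[of A a b "int N" c 0 1 d \<tau>] by simp_all

lemma Gamma1_cases [case_names mat2, cases set: Gamma1]: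
  assumes "A \<in> Gamma1 N"
  obtains m b c d where "A = mat2 (1 + int N * m) b (int N * c) d" "A \<in> SL2Z"
proof -
  have A: "A \<in> SL2Z" using assms by (simp add: Gamma1_def)
  then obtain a b c d where A_eq: "A = mat2 a b c d" by (rule SL2Z_cases)
  have "int N dvd a - 1" "int N dvd c"
    using assms by (simp_all add: Gamma1_def A_eq cong_iff_dvd_diff)
  then obtain m c' where "a - 1 = int N * m" "c = int N * c'" by (meson dvdE)
  then have "A = mat2 (1 + int N * m) b (int N * c') d"
    unfolding A_eq by (simp add: algebra_simps)
  with A show ?thesis using that by blast
qed

lemma Gamma1_imp_SL2Z: "A \<in> Gamma1 N \<Longrightarrow> A \<in> SL2Z"
  by (simp add: Gamma1_def)

lemma slash_eta_power24_Gamma1: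
  assumes A: "A \<in> Gamma1 N" and \<tau>: "Im \<tau> > 0" and N: "N > 0"
  shows "slash 12 (\<lambda>\<tau>. dedekind_eta (of_nat N * \<tau>) ^ 24) A \<tau> = dedekind_eta (of_nat N * \<tau>) ^ 24"
  using A
proof (cases A rule: Gamma1_cases)
  case (mat2 m b c d)
  define B where "B = mat2 (1 + int N * m) (int N * b) c d"
  note B = moebius_act_mult_level[OF mat2, folded B_def]
  have "slash 12 (\<lambda>\<tau>. dedekind_eta (of_nat N * \<tau>) ^ 24) A \<tau> =
      slash 12 (\<lambda>\<tau>. dedekind_eta \<tau> ^ 24) B (of_nat N * \<tau>)"
    unfolding slash_eq B ..
  also have "\<dots> = dedekind_eta (of_nat N * \<tau>) ^ 24"
    using \<tau> N by (intro slash_eta_power24 B) simp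
  finally show ?thesis .
qed

lemma coprime_6_imp_odd: "coprime n (6::nat) \<Longrightarrow> odd n"
  using coprime_common_divisor_nat[of n 6 2] by auto

lemma coprime_6_mod_24:
  assumes "coprime n (6::nat)"
  shows "n mod 24 \<in> {1, 5, 7, 11, 13, 17, 19, 23}"
proof -
  have "coprime n 2" "coprime n 3"
    using assms coprime_mult_right_iff[of n 2 3] by simp_all
  then have "\<not> 2 dvd n" "\<not> 3 dvd n"
    by (auto dest: coprime_common_divisor_nat)
  then have "\<not> 2 dvd n mod 24" "\<not> 3 dvd n mod 24"
    by (simp_all add: dvd_mod_iff)
  moreover have "\<forall>m<24::nat. \<not> 2 dvd m \<longrightarrow> \<not> 3 dvd m \<longrightarrow> m \<in> {1, 5, 7, 11, 13, 17, 19, 23}"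
    by code_simp
  ultimately show ?thesis by simp
qed

lemma cong_square_24:
  assumes "coprime n (6::nat)"
  shows "[int n ^ 2 = 1] (mod 24)"
proof -
  have "[int n ^ 2 = int (n mod 24) ^ 2] (mod 24)"
    by (intro cong_pow) (simp add: cong_def zmod_int)
  also have "[int (n mod 24) ^ 2 = 1] (mod 24)"
    using coprime_6_mod_24[OF assms] by (auto simp: cong_def)
  finally show ?thesis .
qed

definition klein_exponent :: "nat \<Rightarrow> int \<Rightarrow> int \<Rightarrow> nat \<Rightarrow> complex" where
  "klein_exponent N m b j =
     of_nat j * of_int (m + b) + of_nat j ^ 2 * (of_int (m * b) + of_int b / of_nat N)"

lemma klein_division_point_Gamma1:
  assumes A: "A = mat2 (1 + int N * m) b (int N * c) d" "A \<in> SL2Z" and \<tau>: "Im \<tau> > 0" and N: "N > 0"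
  shows "klein (of_nat j / of_nat N) 0 (of_nat N * moebius_act A \<tau>) =
    expi (klein_exponent N m b j) * klein (of_nat j / of_nat N) 0 (of_nat N * \<tau>) / automorphy_factor A \<tau>"
proof -
  define B where "B = mat2 (1 + int N * m) (int N * b) c d"
  define w where "w = of_nat N * \<tau>"
  have w: "Im w > 0" using \<tau> N by (simp add: w_def)
  have B: "B \<in> SL2Z" "of_nat N * moebius_act A \<tau> = moebius_act B w"
    "automorphy_factor B w = automorphy_factor A \<tau>"
    unfolding B_def w_def by (rule moebius_act_mult_level[OF A])+
  then have det: "(1 + int N * m) * d - int N * b * c = 1"
    by (simp add: B_def mat2_in_SL2Z_iff)
  have "of_nat j / of_nat N * of_int (1 + int N * m) + 0 * of_int c =
      of_nat j / of_nat N + (of_int (int j * m) :: complex)"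
    "of_nat j / of_nat N * of_int (int N * b) + 0 * of_int d = 0 + (of_int (int j * b) :: complex)"
    using N by (simp_all add: field_simps)
  moreover have "of_int (int j * m + int j * b + int j * m * (int j * b)) +
      (of_nat j / of_nat N * of_int (int j * b) - of_int (int j * m) * 0) = klein_exponent N m b j"
    by (simp add: klein_exponent_def algebra_simps power2_eq_square)
  ultimately show ?thesis
    using klein_moebius_act[OF det w, of "of_nat j / of_nat N" 0]
    by (simp only: klein_add_int[OF w] B(2,3) flip: B_def w_def)
qed

text \<open>With \<open>24 M = N\<^sup>2 - 1\<close> this is \<open>(-1)\<close> to the power \<open>M m (b + 1)\<close>, and it is 1 because \<open>m\<close> odd and
  \<open>b\<close> even would make the first row \<open>(1 + N m, b)\<close> even.\<close>

lemma expi_sum_klein_exponent: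
  assumes N: "coprime N 6" and det: "(1 + int N * m) * d - b * (int N * c) = 1"
  shows "expi (\<Sum>j=1..N div 2. klein_exponent N m b j) = 1"
proof -
  have "odd N" by (rule coprime_6_imp_odd[OF N])
  then have N0: "N > 0" by (rule odd_pos)
  obtain M where M: "int N ^ 2 = 1 + 24 * M"
    using cong_square_24[OF N] by (metis cong_iff_lin cong_sym)
  have "of_nat N ^ 2 = (of_int (int N ^ 2) :: complex)" by simp
  then have N_squared: "of_nat N ^ 2 = (1 + 24 * of_int M :: complex)" unfolding M by simp
  define l where "l = M * (3 * (m + b) + int N * (m * b) + b)"
  have "(\<Sum>j=1..N div 2. klein_exponent N m b j) =
      (\<Sum>j=1..N div 2. of_nat j) * of_int (m + b) +
      (\<Sum>j=1..N div 2. of_nat j ^ 2) * (of_int (m * b) + of_int b / of_nat N)"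
    by (simp only: klein_exponent_def sum.distrib sum_distrib_right)
  also have "\<dots> = of_int l"
    unfolding sum_of_nat_upto_half[OF \<open>odd N\<close>] sum_of_nat_squares_upto_half[OF \<open>odd N\<close>] N_squared l_def
    using N0 by (simp add: field_simps)
  finally have "expi (\<Sum>j=1..N div 2. klein_exponent N m b j) = expi (of_int l)" by simp
  moreover have "even l"
  proof -
    have "odd ((1 + int N * m) * d - b * (int N * c))" using det by simp
    then show ?thesis using \<open>odd N\<close> by (auto simp: l_def)
  qed
  ultimately show ?thesis by (simp add: expi_of_int)
qed

lemma klein_product_Gamma1:
  assumes A: "A \<in> Gamma1 N" and \<tau>: "Im \<tau> > 0" and N: "coprime N 6"
  shows "klein_product N (moebius_act A \<tau>) = klein_product N \<tau> / automorphy_factor A \<tau> ^ (N div 2)"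
  using A
proof (cases A rule: Gamma1_cases)
  case (mat2 m b c d)
  have "N > 0" using coprime_6_imp_odd[OF N] by (rule odd_pos)
  have "klein_product N (moebius_act A \<tau>) =
      expi (\<Sum>j=1..N div 2. klein_exponent N m b j) * klein_product N \<tau> /
        automorphy_factor A \<tau> ^ (N div 2)"
    unfolding klein_product_def klein_division_point_Gamma1[OF mat2 \<tau> \<open>N > 0\<close>]
    by (simp add: prod.distrib prod_dividef expi_sum)
  also have "expi (\<Sum>j=1..N div 2. klein_exponent N m b j) = 1"
    using mat2 by (intro expi_sum_klein_exponent[OF N]) (simp add: mat2_in_SL2Z_iff)
  finally show ?thesis by simp
qed

lemma eta_quotient_nonzero: "Im \<tau> > 0 \<Longrightarrow> N > 0 \<Longrightarrow> eta_quotient N r s \<tau> \<noteq> 0"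
  by (simp add: eta_quotient_def dedekind_eta_nonzero)

lemma holomorphic_on_eta_quotient:
  assumes "N > 0"
  shows "eta_quotient N r s holomorphic_on upper_half_plane"
  unfolding eta_quotient_def using assms dedekind_eta_nonzero
  by (intro holomorphic_intros holomorphic_on_dedekind_eta open_upper_half_plane) auto

lemma slash_klein_eta_quotient_Gamma1:
  assumes A: "A \<in> Gamma1 N" and \<tau>: "Im \<tau> > 0" and N: "coprime N 6"
  shows "slash (- int (N div 2)) (eta_quotient N 1 (- int N)) A \<tau> = eta_quotient N 1 (- int N) \<tau>"
proof -
  note eta_quotient_eq = eta_quotient_eq_klein_product[OF _ coprime_6_imp_odd[OF N]]
  have "Im (moebius_act A \<tau>) > 0" "automorphy_factor A \<tau> \<noteq> 0"
    using A \<tau> by (simp_all add: Gamma1_imp_SL2Z Im_moebius_act_pos automorphy_factor_nonzero)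
  then show ?thesis
    using \<tau> by (simp add: slash_eq eta_quotient_eq klein_product_Gamma1[OF A \<tau> N])
qed

lemma slash_eta_quotient_Gamma1:
  assumes A: "A \<in> Gamma1 N" and \<tau>: "Im \<tau> > 0" and N: "coprime N 6"
    and weight: "r + s = 2 * k" and dvd: "24 dvd int N * r + s"
  shows "slash k (eta_quotient N r s) A \<tau> = eta_quotient N r s \<tau>"
proof -
  obtain e where e: "int N * r + s = 24 * e" using dvd by blast
  have "odd N" by (rule coprime_6_imp_odd[OF N])
  then have N0: "N > 0" by (rule odd_pos)
  define f where "f = eta_quotient N 1 (- int N)"
  define g where "g = (\<lambda>\<tau>. dedekind_eta (of_nat N * \<tau>) ^ 24)"
  have split: "eta_quotient N r s w = f w powi r * g w powi e" if "Im w > 0" for w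
  proof -
    define x y where "x = dedekind_eta w" and "y = dedekind_eta (of_nat N * w)"
    have "y \<noteq> 0" unfolding y_def using that N0 by (intro dedekind_eta_nonzero) simp
    have "(x * y powi (- int N)) powi r * (y ^ 24) powi e = x powi r * y powi (- int N * r + 24 * e)"
      using \<open>y \<noteq> 0\<close> power_int_add[of y "- int N * r" "24 * e"]
      by (simp add: power_int_mult_distrib power_int_power flip: power_int_mult)
    also have "- int N * r + 24 * e = s" using e by simp
    finally show ?thesis by (simp add: f_def g_def eta_quotient_def x_def y_def)
  qed
  have "int N = 2 * int (N div 2) + 1"
    using \<open>odd N\<close> by (auto elim: oddE)
  then have "2 * (- int (N div 2) * r + 12 * e) = 2 * k"
    using e weight by (simp add: algebra_simps)
  then have k: "k = - int (N div 2) * r + 12 * e" by simp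
  have "slash k (eta_quotient N r s) A \<tau> = slash k (\<lambda>\<tau>. f \<tau> powi r * g \<tau> powi e) A \<tau>"
    using split A \<tau> by (intro slash_cong) (simp_all add: Gamma1_imp_SL2Z)
  also have "\<dots> = slash (- int (N div 2)) f A \<tau> powi r * slash 12 g A \<tau> powi e"
    unfolding k slash_mult[OF Gamma1_imp_SL2Z[OF A] \<tau>] slash_power_int ..
  also have "\<dots> = f \<tau> powi r * g \<tau> powi e"
    using slash_klein_eta_quotient_Gamma1[OF A \<tau> N] slash_eta_power24_Gamma1[OF A \<tau> N0]
    by (simp add: f_def g_def)
  also have "\<dots> = eta_quotient N r s \<tau>" by (rule split[OF \<tau>, symmetric])
  finally show ?thesis .
qed

lemma slash_eta_quotient_power24:
  assumes A: "A \<in> SL2Z" and \<tau>: "Im \<tau> > 0"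
  shows "slash k (eta_quotient N r s) A \<tau> ^ 24 = automorphy_factor A \<tau> powi (12 * (r + s - 2 * k)) *
    ((dedekind_eta \<tau> ^ 24) powi r * slash 12 (\<lambda>\<tau>. dedekind_eta (of_nat N * \<tau>) ^ 24) A \<tau> powi s)"
proof -
  define J t where "J = automorphy_factor A \<tau>" and "t = moebius_act A \<tau>"
  define x y where "x = dedekind_eta t ^ 24" and "y = dedekind_eta (of_nat N * t) ^ 24"
  have J: "J \<noteq> 0" unfolding J_def by (rule automorphy_factor_nonzero[OF A \<tau>])
  have slash_y: "slash 12 (\<lambda>\<tau>. dedekind_eta (of_nat N * \<tau>) ^ 24) A \<tau> = J powi (- 12) * y"
    by (simp add: slash_eq J_def t_def y_def)
  have eta: "dedekind_eta \<tau> ^ 24 = J powi (- 12) * x"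
    using dedekind_eta_power24_moebius_act[OF A \<tau>] J
    by (simp add: J_def t_def x_def power_int_minus)
  have "slash k (eta_quotient N r s) A \<tau> ^ 24 = J powi (- 24 * k) * (x powi r * y powi s)"
    by (simp add: slash_eq eta_quotient_def J_def t_def x_def y_def power_mult_distrib
        power_int_power power_int_power' mult.commute)
  also have "- 24 * k = 12 * (r + s - 2 * k) + (- 12 * r + - 12 * s)" by simp
  also have "J powi \<dots> = J powi (12 * (r + s - 2 * k)) * (J powi (- 12 * r) * J powi (- 12 * s))"
    using J by (simp only: power_int_add simp_thms)
  finally show ?thesis
    unfolding slash_y eta J_def[symmetric] power_int_mult_distrib power_int_mult by (simp only: mult_ac)
qed

section \<open>Orders at the cusps\<close>

lemma expi_surj_punctured_disc:
  assumes "x \<noteq> 0" "norm x < 1"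
  obtains \<tau> where "Im \<tau> > 0" "expi \<tau> = x"
proof
  show "Im (Ln x / (of_real pi * \<i>)) > 0"
    using assms by (simp add: Im_divide power2_eq_square divide_neg_pos mult_neg_pos)
  show "expi (Ln x / (of_real pi * \<i>)) = x"
    using assms by (simp add: expi_def)
qed

lemma holomorphic_at_infinity_iff:
  "holomorphic_at_infinity N F \<longleftrightarrow>
    (\<exists>g. g holomorphic_on ball 0 1 \<and> (\<forall>\<tau>. Im \<tau> > 0 \<longrightarrow> F \<tau> = g (expi (2 * \<tau> / of_nat N))))"
  by (simp add: holomorphic_at_infinity_def Ball_def expi_def mult_ac)

lemma holomorphic_eq_mult_power_int_imp_nonneg:
  assumes S: "open S" "z \<in> S" and g: "g holomorphic_on S" and u: "u holomorphic_on S" "u z \<noteq> 0"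
    and g_eq: "\<And>x. x \<in> S \<Longrightarrow> x \<noteq> z \<Longrightarrow> g x = u x * (x - z) powi l"
  shows "l \<ge> 0"
proof -
  have "zorder g z = l"
    by (rule zorder_eqI[OF S u g_eq])
  moreover have "zorder g z \<ge> 0"
  proof (rule zorder_ge_0)
    show "g analytic_on {z}"
      unfolding analytic_on_holomorphic using g S by blast
    have "isCont u z"
      using holomorphic_on_imp_continuous_on[OF u(1)] S by (simp add: continuous_on_eq_continuous_at)
    then have "eventually (\<lambda>x. u x \<noteq> 0) (at z)"
      unfolding isCont_def using u(2) by (rule tendsto_imp_eventually_ne)
    moreover have "eventually (\<lambda>x. x \<in> S - {z}) (at z)"
      using S by (rule eventually_at_in_open)
    ultimately have "eventually (\<lambda>x. g x \<noteq> 0) (at z)"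
      by eventually_elim (simp add: g_eq)
    then show "frequently (\<lambda>x. g x \<noteq> 0) (at z)"
      by (rule eventually_frequently[rotated]) simp
  qed
  ultimately show ?thesis by simp
qed

lemma holomorphic_at_infinity_iff_order_nonneg:
  assumes N: "N > 0" and u: "u holomorphic_on ball 0 1" "u 0 \<noteq> 0"
    and F: "\<And>\<tau>. Im \<tau> > 0 \<Longrightarrow> F \<tau> = expi (2 * \<tau> / of_nat N) powi l * u (expi (2 * \<tau> / of_nat N))"
  shows "holomorphic_at_infinity N F \<longleftrightarrow> l \<ge> 0"
proof
  assume "l \<ge> 0"
  then have "F \<tau> = expi (2 * \<tau> / of_nat N) ^ nat l * u (expi (2 * \<tau> / of_nat N))" if "Im \<tau> > 0" for \<tau>
    using F[OF that] by (simp add: power_int_nonneg_exp)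
  moreover have "(\<lambda>x. x ^ nat l * u x) holomorphic_on ball 0 1"
    by (intro holomorphic_intros u)
  ultimately show "holomorphic_at_infinity N F"
    unfolding holomorphic_at_infinity_iff by blast
next
  assume "holomorphic_at_infinity N F"
  then obtain g where g: "g holomorphic_on ball 0 1"
      "\<And>\<tau>. Im \<tau> > 0 \<Longrightarrow> F \<tau> = g (expi (2 * \<tau> / of_nat N))"
    unfolding holomorphic_at_infinity_iff by blast
  show "l \<ge> 0"
  proof (rule holomorphic_eq_mult_power_int_imp_nonneg[OF open_ball _ g(1) u])
    fix x :: complex assume "x \<in> ball 0 1" "x \<noteq> 0"
    then have "x \<noteq> 0" "norm x < 1" by auto
    then obtain \<tau> where "Im \<tau> > 0" "expi \<tau> = x"
      by (rule expi_surj_punctured_disc)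
    then show "g x = u x * (x - 0) powi l"
      using F[of "of_nat N * \<tau> / 2"] g(2)[of "of_nat N * \<tau> / 2"] N by simp
  qed simp
qed

lemma holomorphic_power_eq_imp_proportional:
  assumes S: "connected S" "S \<noteq> {}" and f: "f holomorphic_on S" and g: "g holomorphic_on S"
    and nz: "\<And>z. z \<in> S \<Longrightarrow> f z \<noteq> 0" "\<And>z. z \<in> S \<Longrightarrow> g z \<noteq> 0"
    and n: "n > 0" and eq: "\<And>z. z \<in> S \<Longrightarrow> f z ^ n = w * g z ^ n"
  obtains C where "C \<noteq> 0" "\<And>z. z \<in> S \<Longrightarrow> f z = C * g z"
proof -
  have "(\<lambda>z. f z / g z) ` S \<subseteq> {x. x ^ n = w}"
    using nz eq by (auto simp: power_divide)
  then have "finite ((\<lambda>z. f z / g z) ` S)"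
    using finite_nth_roots[OF n] finite_subset by blast
  moreover have "continuous_on S (\<lambda>z. f z / g z)"
    using nz by (intro continuous_intros holomorphic_on_imp_continuous_on f g) auto
  ultimately have "(\<lambda>z. f z / g z) constant_on S"
    using continuous_finite_range_constant[OF S(1)] by blast
  then obtain C where ratio: "\<And>z. z \<in> S \<Longrightarrow> f z / g z = C"
    unfolding constant_on_def by blast
  then have C: "f z = C * g z" if "z \<in> S" for z
    using ratio[OF that] nz(2)[OF that] by (simp add: field_simps)
  moreover have "C \<noteq> 0" using C S(2) nz(1) by fastforce
  ultimately show ?thesis using that by blast
qed

lemma gcd_hermite_cases:
  fixes c d :: int
  assumes N: "N > (0::nat)"
  obtains e g c' f w where "N = e * g" "int e = gcd c (int N)" "c = int e * c'" "d = c' * f + int g * w"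
proof -
  define e where "e = nat (gcd c (int N))"
  have e: "int e = gcd c (int N)" "e > 0" using N by (simp_all add: e_def)
  obtain g where g: "N = e * g" by (metis e(1) gcd_dvd2 int_dvd_int_iff dvdE)
  obtain c' where c': "c = int e * c'" by (metis e(1) gcd_dvd1 dvdE)
  have "coprime c' (int g)"
    using e gcd_mult_distrib_int[of "int e" c' "int g"] by (simp add: g c' coprime_iff_gcd_eq_1)
  then obtain f where "[c' * f = d] (mod int g)"
    using cong_solve_coprime_int by (metis cong_scalar_right mult.assoc mult_1)
  then obtain w where "d = c' * f + int g * w"
    by (metis cong_iff_lin)
  with g e(1) c' show ?thesis by (rule that)
qed

lemma slash_eta_power24_mult_level:
  fixes A :: "int ^ 2 ^ 2"
  assumes A: "A \<in> SL2Z" and N: "N > 0"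
  obtains e g f where "N = e * g" "int e = gcd (A $ 2 $ 1) (int N)"
    "\<And>\<tau>. Im \<tau> > 0 \<Longrightarrow> slash 12 (\<lambda>\<tau>. dedekind_eta (of_nat N * \<tau>) ^ 24) A \<tau> =
      1 / of_nat g ^ 12 * dedekind_eta ((of_nat e * \<tau> + of_int f) / of_nat g) ^ 24"
proof -
  obtain a b c d where A_eq: "A = mat2 a b c d" using A by (rule SL2Z_cases)
  obtain e g c' f w where g: "N = e * g" and e: "int e = gcd c (int N)"
    and c: "c = int e * c'" and d: "d = c' * f + int g * w"
    using gcd_hermite_cases[OF N] .
  have eg: "e > 0" "int g \<noteq> 0" using N g by simp_all
  define B where "B = mat2 (int g * a) (int e * b - a * f) c' w"
  have A_eq': "A = mat2 a b (int e * c') (c' * f + int g * w)" by (simp add: A_eq c d)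
  note B = moebius_act_hermite[OF A_eq' A eg(2), folded B_def]
  show ?thesis
  proof (rule that[of e g f])
    fix \<tau> :: complex assume \<tau>: "Im \<tau> > 0"
    define \<sigma> where "\<sigma> = (of_nat e * \<tau> + of_int f) / of_nat g"
    have "Im \<sigma> > 0" using \<tau> eg by (simp add: \<sigma>_def)
    have "slash 12 (\<lambda>\<tau>. dedekind_eta (of_nat N * \<tau>) ^ 24) A \<tau> =
        automorphy_factor A \<tau> powi (- 12) * dedekind_eta (moebius_act B \<sigma>) ^ 24"
      using B(2)[of \<tau>] by (simp add: slash_eq g \<sigma>_def)
    also have "automorphy_factor A \<tau> = of_nat g * automorphy_factor B \<sigma>"
      using B(3)[of \<tau>] eg by (simp add: \<sigma>_def)
    also have "(of_nat g * automorphy_factor B \<sigma>) powi (- 12) * dedekind_eta (moebius_act B \<sigma>) ^ 24 =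
        1 / of_nat g ^ 12 * slash 12 (\<lambda>\<tau>. dedekind_eta \<tau> ^ 24) B \<sigma>"
      by (simp add: slash_eq power_int_minus power_mult_distrib field_simps)
    also have "slash 12 (\<lambda>\<tau>. dedekind_eta \<tau> ^ 24) B \<sigma> = dedekind_eta \<sigma> ^ 24"
      by (rule slash_eta_power24[OF B(1) \<open>Im \<sigma> > 0\<close>])
    finally show "slash 12 (\<lambda>\<tau>. dedekind_eta (of_nat N * \<tau>) ^ 24) A \<tau> =
      1 / of_nat g ^ 12 * dedekind_eta \<sigma> ^ 24" .
  next
    show "N = e * g" by (rule g)
    show "int e = gcd (A $ 2 $ 1) (int N)" using e by (simp only: A_eq mat2_nth)
  qed
qed

lemma slash_eta_quotient_eq_eta_product:
  fixes A :: "int ^ 2 ^ 2"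
  assumes A: "A \<in> SL2Z" and N: "N > 0" and weight: "r + s = 2 * k"
  obtains e g f C where "N = e * g" "int e = gcd (A $ 2 $ 1) (int N)" "C \<noteq> 0"
    "\<And>\<tau>. Im \<tau> > 0 \<Longrightarrow> slash k (eta_quotient N r s) A \<tau> =
      C * (dedekind_eta \<tau> powi r * dedekind_eta ((of_nat e * \<tau> + of_int f) / of_nat g) powi s)"
proof -
  obtain e g f where eg: "N = e * g" "int e = gcd (A $ 2 $ 1) (int N)"
    and scaled: "\<And>\<tau>. Im \<tau> > 0 \<Longrightarrow> slash 12 (\<lambda>\<tau>. dedekind_eta (of_nat N * \<tau>) ^ 24) A \<tau> =
      1 / of_nat g ^ 12 * dedekind_eta ((of_nat e * \<tau> + of_int f) / of_nat g) ^ 24"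
    by (rule slash_eta_power24_mult_level[OF A N]) blast
  define \<sigma> :: "complex \<Rightarrow> complex" where "\<sigma> = (\<lambda>\<tau>. (of_nat e * \<tau> + of_int f) / of_nat g)"
  have \<sigma>: "Im (\<sigma> \<tau>) > 0" if "Im \<tau> > 0" for \<tau>
    using that N eg(1) by (simp add: \<sigma>_def)
  have \<sigma>_hol: "\<sigma> holomorphic_on upper_half_plane"
    unfolding \<sigma>_def using N eg(1) by (intro holomorphic_intros) auto
  obtain C where "C \<noteq> 0" "\<And>\<tau>. \<tau> \<in> upper_half_plane \<Longrightarrow> slash k (eta_quotient N r s) A \<tau> =
      C * (dedekind_eta \<tau> powi r * dedekind_eta (\<sigma> \<tau>) powi s)"
  proof (rule holomorphic_power_eq_imp_proportional[where n = 24])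
    show "slash k (eta_quotient N r s) A holomorphic_on upper_half_plane"
      by (intro holomorphic_on_slash A holomorphic_on_eta_quotient N)
    show "(\<lambda>\<tau>. dedekind_eta \<tau> powi r * dedekind_eta (\<sigma> \<tau>) powi s) holomorphic_on upper_half_plane"
      using \<sigma> dedekind_eta_nonzero
      by (intro holomorphic_intros holomorphic_on_dedekind_eta \<sigma>_hol open_upper_half_plane) auto
    fix \<tau> assume "\<tau> \<in> upper_half_plane"
    then have \<tau>: "Im \<tau> > 0" by simp
    show "slash k (eta_quotient N r s) A \<tau> \<noteq> 0"
      using automorphy_factor_nonzero[OF A \<tau>] eta_quotient_nonzero[OF Im_moebius_act_pos[OF A \<tau>] N]
      by (simp add: slash_eq)
    show "dedekind_eta \<tau> powi r * dedekind_eta (\<sigma> \<tau>) powi s \<noteq> 0"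
      using dedekind_eta_nonzero[OF \<tau>] dedekind_eta_nonzero[OF \<sigma>[OF \<tau>]] by simp
    show "slash k (eta_quotient N r s) A \<tau> ^ 24 = (1 / of_nat g ^ 12) powi s *
        (dedekind_eta \<tau> powi r * dedekind_eta (\<sigma> \<tau>) powi s) ^ 24"
      unfolding slash_eta_quotient_power24[OF A \<tau>] weight scaled[OF \<tau>] power_int_mult_distrib
      by (simp add: \<sigma>_def power_mult_distrib power_int_power power_int_power' mult_ac)
  next
    have "\<i> \<in> upper_half_plane" by simp
    then show "upper_half_plane \<noteq> {}" by blast
  qed (simp_all add: connected_upper_half_plane)
  then show ?thesis
    unfolding \<sigma>_def by (intro that[OF eg, of C f]) simp_all
qed

lemma eta_product_expansion:
  fixes e g N :: nat and f r s l :: int and \<tau> :: complex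
  assumes N: "N > 0" "N = e * g" and l: "int N * r + int e ^ 2 * s = 24 * l"
  defines "x \<equiv> expi (2 * \<tau> / of_nat N)"
    and "\<zeta> \<equiv> expi (2 * of_int f / of_nat g)"
  shows "dedekind_eta \<tau> powi r * dedekind_eta ((of_nat e * \<tau> + of_int f) / of_nat g) powi s =
    expi (of_int (s * f) / (12 * of_nat g)) *
    (x powi l * (qpoch (x ^ N) (x ^ N) powi r * qpoch (\<zeta> * x ^ e\<^sup>2) (\<zeta> * x ^ e\<^sup>2) powi s))"
proof -
  define \<sigma> where "\<sigma> = (of_nat e * \<tau> + of_int f) / of_nat g"
  have eg: "e > 0" "g > 0" using N by auto
  have nome: "expi (2 * \<tau>) = x ^ N"
    unfolding x_def expi_mult_of_nat[symmetric] using N(1) by simp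
  have nome_\<sigma>: "expi (2 * \<sigma>) = \<zeta> * x ^ e\<^sup>2"
    unfolding x_def \<zeta>_def expi_mult_of_nat[symmetric] expi_add[symmetric]
    using eg by (intro arg_cong[of _ _ expi]) (simp add: \<sigma>_def N(2) field_simps power2_eq_square)
  have "of_nat N * of_int r + of_nat e ^ 2 * of_int s = (of_int (int N * r + int e ^ 2 * s) :: complex)"
    by simp
  then have l': "of_nat e * (of_nat g * of_int r + of_nat e * of_int s) = (24 * of_int l :: complex)"
    unfolding l by (simp add: N(2) power2_eq_square algebra_simps)
  have "of_int r * (\<tau> / 12) + of_int s * (\<sigma> / 12) = of_int (s * f) / (12 * of_nat g) +
      of_nat e * (of_nat g * of_int r + of_nat e * of_int s) * (2 * \<tau> / of_nat N) / 24"
    using eg by (simp add: \<sigma>_def N(2) field_simps)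
  also have "\<dots> = of_int (s * f) / (12 * of_nat g) + of_int l * (2 * \<tau> / of_nat N)"
    unfolding l' by simp
  finally have prefactor: "expi (\<tau> / 12) powi r * expi (\<sigma> / 12) powi s =
      expi (of_int (s * f) / (12 * of_nat g)) * x powi l"
    by (simp only: x_def expi_mult_of_int[symmetric] expi_add[symmetric])
  have "dedekind_eta \<tau> powi r * dedekind_eta \<sigma> powi s =
      (expi (\<tau> / 12) powi r * expi (\<sigma> / 12) powi s) *
      (qpoch (x ^ N) (x ^ N) powi r * qpoch (\<zeta> * x ^ e\<^sup>2) (\<zeta> * x ^ e\<^sup>2) powi s)"
    unfolding dedekind_eta_eq_qpoch nome nome_\<sigma> power_int_mult_distrib by (simp only: mult_ac)
  then show ?thesis
    unfolding \<sigma>_def[symmetric] prefactor by (simp only: mult.assoc)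
qed

lemma holomorphic_at_infinity_slash_eta_quotient:
  fixes A :: "int ^ 2 ^ 2"
  assumes A: "A \<in> SL2Z" and N: "N > 0" and weight: "r + s = 2 * k"
    and dvd: "24 dvd int N * r + (gcd (A $ 2 $ 1) (int N))\<^sup>2 * s"
  shows "holomorphic_at_infinity N (slash k (eta_quotient N r s) A) \<longleftrightarrow>
    int N * r + (gcd (A $ 2 $ 1) (int N))\<^sup>2 * s \<ge> 0"
proof -
  obtain e g f C where e: "N = e * g" "int e = gcd (A $ 2 $ 1) (int N)" and "C \<noteq> 0"
    and slash: "\<And>\<tau>. Im \<tau> > 0 \<Longrightarrow> slash k (eta_quotient N r s) A \<tau> =
      C * (dedekind_eta \<tau> powi r * dedekind_eta ((of_nat e * \<tau> + of_int f) / of_nat g) powi s)"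
    by (rule slash_eta_quotient_eq_eta_product[OF A N weight]) blast
  obtain l where l: "int N * r + int e ^ 2 * s = 24 * l"
    using dvd unfolding e(2)[symmetric] by blast
  define \<zeta> where "\<zeta> = expi (2 * of_int f / of_nat g)"
  define C' where "C' = C * expi (of_int (s * f) / (12 * of_nat g))"
  define u where "u = (\<lambda>x. C' * (qpoch (x ^ N) (x ^ N) powi r *
      qpoch (\<zeta> * x ^ e\<^sup>2) (\<zeta> * x ^ e\<^sup>2) powi s))"
  have "e > 0" using N e(1) by simp
  have small: "norm (x ^ N) < 1" "norm (\<zeta> * x ^ e\<^sup>2) < 1" if "x \<in> ball 0 1" for x
    using that N \<open>e > 0\<close> by (simp_all add: \<zeta>_def norm_mult norm_expi norm_power power_less_one_iff)
  have "u holomorphic_on ball 0 1"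
    unfolding u_def using small by (intro holomorphic_intros) (auto simp: qpoch_nonzero)
  moreover have "u 0 \<noteq> 0"
    using N \<open>e > 0\<close> \<open>C \<noteq> 0\<close> by (simp add: u_def C'_def power_0_left)
  moreover have "slash k (eta_quotient N r s) A \<tau> =
      expi (2 * \<tau> / of_nat N) powi l * u (expi (2 * \<tau> / of_nat N))" if "Im \<tau> > 0" for \<tau>
    unfolding slash[OF that] eta_product_expansion[OF N e(1) l] u_def C'_def \<zeta>_def
    by (simp only: mult_ac)
  ultimately have "holomorphic_at_infinity N (slash k (eta_quotient N r s) A) \<longleftrightarrow> l \<ge> 0"
    by (rule holomorphic_at_infinity_iff_order_nonneg[OF N])
  then show ?thesis unfolding e(2)[symmetric] l by simp
qed

lemma eta_quotient_add_1:
  "eta_quotient N r s (\<tau> + 1) = expi (of_int (r + int N * s) / 12) * eta_quotient N r s \<tau>"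
proof -
  have "of_nat N * (\<tau> + 1) = of_nat N * \<tau> + of_int (int N)" by (simp add: ring_distribs)
  then have "eta_quotient N r s (\<tau> + 1) =
      expi (of_int 1 / 12) powi r * expi (of_int (int N) / 12) powi s * eta_quotient N r s \<tau>"
    using dedekind_eta_add_int[of \<tau> 1] dedekind_eta_add_int[of "of_nat N * \<tau>" "int N"]
    by (simp add: eta_quotient_def power_int_mult_distrib)
  also have "expi (of_int 1 / 12) powi r * expi (of_int (int N) / 12) powi s =
      expi (of_int (r + int N * s) / 12)"
    unfolding expi_mult_of_int[symmetric] expi_add[symmetric]
    by (rule arg_cong[of _ _ expi]) (simp add: field_simps)
  finally show ?thesis .
qed

lemma modular_eta_quotient_weight:
  assumes N: "N > 0" and modular: "eta_quotient N r s \<in> modular_forms_Gamma1 k N"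
  shows "r + s = 2 * k"
proof -
  define A where "A = mat2 1 0 (int N) 1"
  have A: "A \<in> Gamma1 N" by (simp add: A_def Gamma1_def mat2_in_SL2Z_iff cong_0_iff)
  define J where "J = automorphy_factor A \<i>"
  define l where "l = 12 * (r + s - 2 * k)"
  have "norm J ^ 2 = real N ^ 2 + 1" by (simp add: J_def A_def cmod_power2)
  also have "\<dots> > 1 ^ 2" using N by simp
  finally have "norm J > 1" by (rule power2_less_imp_less) simp
  have "slash k (eta_quotient N r s) A \<i> = eta_quotient N r s \<i>"
    using modular A by (simp add: modular_forms_Gamma1_def)
  then have "eta_quotient N r s \<i> ^ 24 =
      J powi l * ((dedekind_eta \<i> ^ 24) powi r * (dedekind_eta (of_nat N * \<i>) ^ 24) powi s)"
    using slash_eta_quotient_power24[OF Gamma1_imp_SL2Z[OF A], of \<i> k N r s]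
      slash_eta_power24_Gamma1[OF A _ N, of \<i>] by (simp add: J_def l_def)
  also have "\<dots> = J powi l * eta_quotient N r s \<i> ^ 24"
    by (simp add: eta_quotient_def power_mult_distrib power_int_power power_int_power' mult.commute)
  finally have "J powi l = 1"
    using eta_quotient_nonzero[of \<i> N r s] N by simp
  then have norm_powi: "norm J powi l = 1" by (metis norm_one norm_power_int)
  have "l = 0"
  proof (rule ccontr)
    assume "l \<noteq> 0"
    then show False
      using norm_powi \<open>norm J > 1\<close> power_int_strict_increasing[of 0 l "norm J"]
        power_int_strict_increasing[of l 0 "norm J"] by (cases "l > 0") auto
  qed
  then show ?thesis by (simp add: l_def)
qed

lemma dvd_24_mult_square_iff:
  assumes "coprime n (6::nat)"
  shows "24 dvd a + int n ^ 2 * b \<longleftrightarrow> 24 dvd a + b"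
proof -
  have "[a + int n ^ 2 * b = a + 1 * b] (mod 24)"
    by (intro cong_add cong_mult cong_refl cong_square_24 assms)
  then show ?thesis using cong_dvd_iff by fastforce
qed

lemma modular_eta_quotient_dvd:
  assumes N: "coprime N 6" and modular: "eta_quotient N r s \<in> modular_forms_Gamma1 k N"
  shows "24 dvd int N * r + s"
proof -
  have N0: "N > 0" using coprime_6_imp_odd[OF N] by (rule odd_pos)
  define T where "T = mat2 1 1 0 1"
  have "T \<in> Gamma1 N" by (simp add: T_def Gamma1_def mat2_in_SL2Z_iff)
  then have "slash k (eta_quotient N r s) T \<i> = eta_quotient N r s \<i>"
    using modular by (simp add: modular_forms_Gamma1_def)
  then have "eta_quotient N r s (\<i> + 1) = eta_quotient N r s \<i>"
    by (simp add: slash_eq T_def moebius_act_mat2)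
  then have "expi (of_int (r + int N * s) / 12) = 1"
    using eta_quotient_nonzero[of \<i> N r s] N0 by (simp add: eta_quotient_add_1)
  then obtain l :: int where "of_int (r + int N * s) / 12 = (2 * of_int l :: complex)"
    unfolding expi_eq_1_iff by blast
  then have "of_int (r + int N * s) = (of_int (24 * l) :: complex)" by (simp add: field_simps)
  then have "r + int N * s = 24 * l" by (simp only: of_int_eq_iff)
  moreover have "int N * r + int N ^ 2 * s = int N * (r + int N * s)"
    by (simp add: power2_eq_square algebra_simps)
  ultimately have "24 dvd int N * r + int N ^ 2 * s" by simp
  then show ?thesis by (simp only: dvd_24_mult_square_iff[OF N])
qed

lemma cusp_order_nonneg:
  fixes N e r s :: int
  assumes "0 < e" "e \<le> N" and "N * r + s \<ge> 0" "r + N * s \<ge> 0"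
  shows "N * r + e\<^sup>2 * s \<ge> 0"
proof (cases "s \<ge> 0")
  case True
  then have "1 * s \<le> e\<^sup>2 * s"
    using assms(1) by (intro mult_right_mono) simp_all
  then show ?thesis using assms(3) by linarith
next
  case False
  then have "N\<^sup>2 * s \<le> e\<^sup>2 * s"
    using assms(1,2) by (intro mult_right_mono_neg power_mono) auto
  moreover have "N * r + N\<^sup>2 * s = N * (r + N * s)" by (simp add: power2_eq_square algebra_simps)
  moreover have "N * (r + N * s) \<ge> 0" using assms by simp
  ultimately show ?thesis by linarith
qed

theorem eta_quotient_modular_iff:
  assumes N: "coprime N 6"
  shows "eta_quotient N r s \<in> modular_forms_Gamma1 k N \<longleftrightarrow>
    r + s = 2 * k \<and> 24 dvd int N * r + s \<and> r + int N * s \<ge> 0 \<and> int N * r + s \<ge> 0"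
    (is "?modular \<longleftrightarrow> ?conditions")
proof -
  have N0: "N > 0" using coprime_6_imp_odd[OF N] by (rule odd_pos)
  have holomorphic_iff: "holomorphic_at_infinity N (slash k (eta_quotient N r s) A) \<longleftrightarrow>
      int N * r + (gcd (A $ 2 $ 1) (int N))\<^sup>2 * s \<ge> 0"
    if "A \<in> SL2Z" "r + s = 2 * k" "24 dvd int N * r + s" for A :: "int ^ 2 ^ 2"
  proof (rule holomorphic_at_infinity_slash_eta_quotient[OF that(1) N0 that(2)])
    obtain e where e: "gcd (A $ 2 $ 1) (int N) = int e" by (metis gcd_ge_0_int nonneg_int_cases)
    then have "e dvd N" by (metis gcd_dvd2 int_dvd_int_iff)
    then have "coprime e 6" by (rule coprime_divisors[OF _ dvd_refl N])
    then show "24 dvd int N * r + (gcd (A $ 2 $ 1) (int N))\<^sup>2 * s"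
      unfolding e using that(3) by (simp only: dvd_24_mult_square_iff)
  qed
  show ?thesis
  proof
    assume ?modular
    then have weight: "r + s = 2 * k" and dvd: "24 dvd int N * r + s"
      using modular_eta_quotient_weight[OF N0] modular_eta_quotient_dvd[OF N] by blast+
    have cusp: "int N * r + (gcd (A $ 2 $ 1) (int N))\<^sup>2 * s \<ge> 0" if "A \<in> SL2Z" for A :: "int ^ 2 ^ 2"
      using \<open>?modular\<close> that holomorphic_iff[OF that weight dvd] by (auto simp: modular_forms_Gamma1_def)
    have "int N * r + s \<ge> 0"
      using cusp[of "mat2 0 (- 1) 1 0"] by (simp add: mat2_in_SL2Z_iff)
    moreover have "int N * (r + int N * s) \<ge> 0"
      using cusp[of "mat2 1 0 0 1"] by (simp add: mat2_in_SL2Z_iff power2_eq_square algebra_simps)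
    then have "r + int N * s \<ge> 0" using N0 by (simp add: zero_le_mult_iff)
    ultimately show ?conditions using weight dvd by blast
  next
    assume ?conditions
    moreover have "int N * r + (gcd c (int N))\<^sup>2 * s \<ge> 0" for c
      using \<open>?conditions\<close> N0 by (intro cusp_order_nonneg) (auto intro: zdvd_imp_le)
    ultimately show ?modular
      by (simp add: modular_forms_Gamma1_def holomorphic_on_eta_quotient N0
          slash_eta_quotient_Gamma1[OF _ _ N] holomorphic_iff)
  qed
qed

section \<open>Admissible exponents\<close>

lemma gcd_div_2_dvd_weight:
  fixes r s k :: int
  assumes n: "odd n" and weight: "r + s = 2 * k" and dvd: "24 dvd int n * r + s"
  shows "int (gcd (n - 1) 24 div 2) dvd k"
proof -
  define g where "g = gcd (n - 1) 24"
  have "int g dvd int (n - 1)" "int g dvd 24"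
    unfolding g_def by (simp, metis gcd_dvd2 int_dvd_int_iff of_nat_numeral)
  then have "int g dvd (int n * r + s) - int (n - 1) * r"
    using dvd by (meson dvd_diff dvd_mult2 dvd_trans)
  also have "(int n * r + s) - int (n - 1) * r = 2 * k"
    using n weight by (cases n) (simp_all add: algebra_simps)
  finally have "int g dvd 2 * k" .
  moreover have "even g" using n by (simp add: g_def)
  then have "int g = 2 * int (g div 2)" by auto
  ultimately show ?thesis by (simp add: g_def)
qed

lemma exponent_nonneg:
  fixes n r s :: int
  assumes "n * r + s \<ge> 0" "r + s < n - 1" "n \<ge> 1"
  shows "r \<ge> 0"
proof (rule ccontr)
  assume "\<not> r \<ge> 0"
  then have "(n - 1) * r \<le> (n - 1) * (- 1)"
    using assms(3) by (intro mult_left_mono) auto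
  with assms(1,2) show False by (simp add: algebra_simps)
qed

lemma no_weight_2_exponents:
  fixes r s :: int
  assumes n: "[n = 5] (mod 24)" "n \<noteq> 5" and weight: "r + s = 4" and dvd: "24 dvd int n * r + s"
    and nonneg: "r + int n * s \<ge> 0" "int n * r + s \<ge> 0"
  shows False
proof -
  have "n mod 24 = 5" using n(1) by (simp add: cong_def)
  then obtain t where t: "n = 24 * t + 5" by (metis div_mod_decomp mult.commute)
  with n(2) have "int n > 5" by (cases t) auto
  then have "r \<ge> 0" "s \<ge> 0"
    using exponent_nonneg[of "int n" r s] exponent_nonneg[of "int n" s r] weight nonneg
    by (simp_all add: add.commute)
  have "int n * r + s = 24 * (int t * r) + (4 * r + 4)"
    using weight by (simp add: t algebra_simps)
  then have "24 dvd 4 * r + 4" using dvd by (metis dvd_add_right_iff dvd_triv_left)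
  then have "r mod 6 = 5" by presburger
  with \<open>r \<ge> 0\<close> \<open>s \<ge> 0\<close> weight show False by presburger
qed

lemma nonneg_exponent_exists_residue_5:
  fixes k :: int
  assumes k: "even k" "k \<ge> 0" "k \<noteq> 2"
  shows "\<exists>r. 0 \<le> r \<and> r \<le> 2 * k \<and> 24 dvd 4 * r + 2 * k"
proof -
  define r where "r = (- (k div 2)) mod 6"
  have "0 \<le> r" "r < 6" by (simp_all add: r_def)
  moreover have "k = 0 \<or> k \<ge> 4" using k by presburger
  then have "r \<le> 2 * k" using \<open>r < 6\<close> by (auto simp: r_def)
  moreover have "24 dvd 4 * r + 2 * k"
  proof -
    have "6 dvd r + k div 2" unfolding r_def by presburger
    then obtain m where "r + k div 2 = 6 * m" by blast
    moreover have "4 * r + 2 * k = 4 * (r + k div 2)" using k(1) by auto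
    ultimately show ?thesis by simp
  qed
  ultimately show ?thesis by blast
qed

lemma nonneg_exponent_exists_residue:
  fixes \<rho> :: nat and k :: int
  assumes \<rho>: "\<rho> \<in> {1, 5, 7, 11, 13, 17, 19, 23}" and k: "even k" "k \<ge> 0"
    and dvd: "int (gcd (\<rho> - 1) 24 div 2) dvd k" and exceptional: "\<rho> = 5 \<Longrightarrow> k \<noteq> 2"
  shows "\<exists>r. 0 \<le> r \<and> r \<le> 2 * k \<and> 24 dvd (int \<rho> - 1) * r + 2 * k"
proof -
  consider (half_gcd_12) "\<rho> = 1" | (residue_5) "\<rho> = 5" | (half_gcd_3) "\<rho> = 7 \<or> \<rho> = 19"
    | (half_gcd_1) "\<rho> = 11 \<or> \<rho> = 23" | (half_gcd_6) "\<rho> = 13" | (half_gcd_4) "\<rho> = 17"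
    using \<rho> by auto
  then show ?thesis
  proof cases
    case half_gcd_12
    then have "12 dvd k" using dvd by simp
    then show ?thesis using k half_gcd_12 by (intro exI[of _ 0]) auto
  next
    case residue_5
    then show ?thesis using nonneg_exponent_exists_residue_5[OF k] exceptional by simp
  next
    case half_gcd_3
    have "gcd 6 24 = (6::nat)" "gcd 18 24 = (6::nat)" by (simp_all add: gcd_nat.simps)
    then have "3 dvd k" using dvd half_gcd_3 by auto
    then have "6 dvd k" using k by presburger
    then obtain m where "k = 6 * m" by blast
    then show ?thesis using k half_gcd_3 by (intro exI[of _ "2 * m"]) auto
  next
    case half_gcd_1
    then show ?thesis using k by (intro exI[of _ k]) auto
  next
    case half_gcd_6
    have "gcd 12 24 = (12::nat)" by (simp add: gcd_nat.simps)
    then have "6 dvd k" using dvd half_gcd_6 by simp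
    then obtain m where "k = 6 * m" by blast
    then show ?thesis using k half_gcd_6 by (intro exI[of _ m]) auto
  next
    case half_gcd_4
    have "gcd 16 24 = (8::nat)" by (simp add: gcd_nat.simps)
    then have "4 dvd k" using dvd half_gcd_4 by simp
    then obtain m where "k = 4 * m" by blast
    then show ?thesis using k half_gcd_4 by (intro exI[of _ m]) auto
  qed
qed

lemma nonneg_exponent_exists:
  fixes n :: nat and k :: int
  assumes n: "coprime n 6" and k: "even k" "k \<ge> 0"
    and dvd: "int (gcd (n - 1) 24 div 2) dvd k" and exceptional: "n mod 24 = 5 \<Longrightarrow> k \<noteq> 2"
  shows "\<exists>r. 0 \<le> r \<and> r \<le> 2 * k \<and> 24 dvd (int n - 1) * r + 2 * k"
proof -
  define \<rho> where "\<rho> = n mod 24"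
  have \<rho>: "\<rho> \<in> {1, 5, 7, 11, 13, 17, 19, 23}"
    unfolding \<rho>_def by (rule coprime_6_mod_24[OF n])
  have n_eq: "n = 24 * (n div 24) + \<rho>" by (simp add: \<rho>_def)
  then have "n - 1 = 24 * (n div 24) + (\<rho> - 1)" using \<rho> by auto
  then have "gcd (n - 1) 24 = gcd (\<rho> - 1) 24"
    by (metis gcd.commute gcd_add_mult mult.commute add.commute)
  then obtain r where r: "0 \<le> r" "r \<le> 2 * k" "24 dvd (int \<rho> - 1) * r + 2 * k"
    using nonneg_exponent_exists_residue[OF \<rho> k] dvd exceptional by (auto simp: \<rho>_def)
  have "(int n - 1) * r + 2 * k = 24 * (int (n div 24) * r) + ((int \<rho> - 1) * r + 2 * k)"
    by (subst n_eq) (simp add: algebra_simps)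
  then have "24 dvd (int n - 1) * r + 2 * k" using r(3) by (metis dvd_add dvd_triv_left)
  with r show ?thesis by blast
qed

lemma eta_exponents_exist_iff:
  fixes n :: nat and k :: int
  assumes n: "coprime n 6" and k: "even k" "k \<ge> 0"
  shows "(\<exists>r s. r + s = 2 * k \<and> 24 dvd int n * r + s \<and> r + int n * s \<ge> 0 \<and> int n * r + s \<ge> 0) \<longleftrightarrow>
    int (gcd (n - 1) 24 div 2) dvd k \<and> \<not> (n \<noteq> 5 \<and> [n = 5] (mod 24) \<and> k = 2)"
    (is "?exponents \<longleftrightarrow> ?conditions")
proof
  assume ?exponents
  then show ?conditions
    using gcd_div_2_dvd_weight[OF coprime_6_imp_odd[OF n]] no_weight_2_exponents[of n] by fastforce
next
  assume conditions: ?conditions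
  show ?exponents
  proof (cases "n = 5 \<and> k = 2")
    case True
    then show ?thesis by (intro exI[of _ "-1"] exI[of _ 5]) simp
  next
    case False
    then have "n mod 24 = 5 \<Longrightarrow> k \<noteq> 2"
      using conditions by (auto simp: cong_def)
    then obtain r where r: "0 \<le> r" "r \<le> 2 * k" "24 dvd (int n - 1) * r + 2 * k"
      using nonneg_exponent_exists[OF n k] conditions by blast
    define s where "s = 2 * k - r"
    have "int n * r + s = (int n - 1) * r + 2 * k" by (simp add: s_def algebra_simps)
    then have "24 dvd int n * r + s" using r(3) by simp
    moreover have "r + s = 2 * k" "r + int n * s \<ge> 0" "int n * r + s \<ge> 0"
      using r(1,2) by (simp_all add: s_def)
    ultimately show ?thesis by blast
  qed
qed

theorem theorem1p9:
  fixes p h :: nat and k :: int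
  assumes "prime p" and "p \<ge> 5"
    and "h = gcd (p - 1) 24 div 2"
    and "even k" and "k \<ge> 0"
  shows "(\<exists>r\<^sub>1 r\<^sub>p :: int.
            (\<lambda>\<tau>. dedekind_eta \<tau> powi r\<^sub>1 * dedekind_eta (of_nat p * \<tau>) powi r\<^sub>p)
              \<in> modular_forms_Gamma1 k p) \<longleftrightarrow>
         int h dvd k \<and> \<not> (p \<noteq> 5 \<and> [p = 5] (mod 24) \<and> k = 2)"
proof -
  have "\<not> p dvd 2" "\<not> p dvd 3" using \<open>p \<ge> 5\<close> by (auto dest: dvd_imp_le)
  then have "\<not> p dvd 2 * 3" using \<open>prime p\<close> by (simp only: prime_dvd_mult_iff simp_thms)
  then have "coprime p 6" using \<open>prime p\<close> by (simp add: prime_imp_coprime)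
  moreover have "(\<lambda>\<tau>. dedekind_eta \<tau> powi r * dedekind_eta (of_nat p * \<tau>) powi s) =
      eta_quotient p r s" for r s
    by (simp add: fun_eq_iff eta_quotient_def)
  ultimately show ?thesis
    by (simp only: eta_quotient_modular_iff eta_exponents_exist_iff assms)
qed

end
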